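(* Let $B=k[X_1,\ldots,X_n]/I=k[x_1,\ldots,x_n]$ be a finitely generated $k$-domain, and let $\partial$ be a locally nilpotent $k$-derivation of $B$ whose kernel is a finitely generated $k$-algebra, with data $z_1,\ldots,z_r$, $s_1,\ldots,s_m$, $d_1,\ldots,d_n$, $\mathcal G$, $J$, $\omega$ and $\hat J$ as described in the context. If the $\mathbb N$-filtration $\mathcal G$ is proper, then $$\mathrm{Gr}_\partial(B)\simeq k^{[r+n+m]}/\hat J .$$
   Context: $k$ is a field of characteristic zero; $\mathbb N=\mathbb Z_{\ge 0}$; $k^{[N]}$ is the polynomial ring in $N$ variables over $k$. A $k$-derivation $\partial$ of $B$ is locally nilpotent if every $a\in B$ satisfies $\partial^n(a)=0$ for some $n\ge 0$; $\deg_\partial(a):=\min\{i\in\mathbb N\mid\partial^{i+1}(a)=0\}$ for $a\neq 0$, $\deg_\partial(0)=-\infty$. The $\partial$-filtration is $\mathcal F_i=\ker\partial^{i+1}$ ($\mathcal F_{-1}=0$), and $\mathrm{Gr}_\partial(B)=\bigoplus_{i\in\mathbb N}\mathcal F_i/\mathcal F_{i-1}$ is its associated graded algebra, with product $(a+\mathcal F_{i-1})(b+\mathcal F_{j-1})=ab+\mathcal F_{i+j-1}$. An $\mathbb N$-filtration of $B$ is a family $\{\mathcal G_i\}_{i\in\mathbb N}$ of $k$-subspaces with $\mathcal G_i\subset\mathcal G_{i+1}$, $B=\bigcup_i\mathcal G_i$, $\mathcal G_i\mathcal G_j\subset\mathcal G_{i+j}$; it is proper if moreover $a\in\mathcal G_i\setminus\mathcal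 G_{i-1}$, $b\in\mathcal G_j\setminus\mathcal G_{j-1}$ imply $ab\in\mathcal G_{i+j}\setminus\mathcal G_{i+j-1}$ (with $\mathcal G_{-1}=0$). Data. It is assumed that the origin lies in $\mathrm{Spec}(B)$, that is, $I\subset(X_1,\ldots,X_n)$. The algebra $\ker\partial=\mathcal F_0$ is generated by $z_1,\ldots,z_r\in B$ with $z_j(0,\ldots,0)=0$. The elements $s_1,\ldots,s_m\in\mathcal F_1$ are irreducible, satisfy $s_i(0,\ldots,0)=0$, $\deg_\partial(s_i)=1$, and $\mathcal F_1=\mathcal F_0s_1+\cdots+\mathcal F_0s_m+\mathcal F_0$, the elements $\partial(s_1),\ldots,\partial(s_m)$ being generators of the plinth ideal $\ker\partial\cap\partial(B)$ of $\ker\partial$. Put $d_i=\deg_\partial(x_i)$. The filtration $\mathcal G$ is $\mathcal G_i=\sum_{j\le i}H_j$ with $$H_j=\sum_{\sum_l u_l+\sum_i d_iv_i=j}\mathcal F_0\,\bigl(s_1^{u_1}\cdots s_m^{u_m}x_1^{v_1}\cdots x_n^{v_n}\bigr),\quad u_l,v_i\in\mathbb N.$$ Choosing polynomials $z_j(X_1,\ldots,X_n)$, $s_i(X_1,\ldots,X_n)$ representing $z_j$, $s_i$, the ideal $J\subset k^{[r+n+m]}=k[Z_1,\ldots,Z_r][X_1,\ldots,X_n][S_1,\ldots,S_m]$ is generated by $I$, the elements $Z_j-z_j(X_1,\ldots,X_n)$ ($1\le j\le r$) and $S_i-s_i(X_1,\ldots,X_n)$ ($1\le i\le m$), so that $B\simeq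 k^{[r+n+m]}/J$. The $\mathbb N$-weight degree function $\omega$ on $k^{[r+n+m]}$ is defined by the weights $\omega(Z_i)=0$, $\omega(S_i)=1$, $\omega(X_i)=d_i$. The ideal $\hat J$ is the homogeneous ideal generated by the highest homogeneous components, relative to $\omega$, of all elements of $J$. *)

theory Defs
  imports
    "HOL-Library.Poly_Mapping"
    "HOL-Library.Set_Algebras"
    "HOL-Library.Extended_Real"
    "HOL-Computational_Algebra.Factorial_Ring"
    "HOL-Algebra.QuotRing"
begin

locale k_algebra = vector_space scale
  for scale :: "'k::field \<Rightarrow> 'b::comm_ring_1 \<Rightarrow> 'b" +
  assumes scale_mult_left: "scale c (a * b) = scale c a * b"

definition subalgebra :: "('k::field \<Rightarrow> 'b::comm_ring_1 \<Rightarrow> 'b) \<Rightarrow> 'b set \<Rightarrow> bool" where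
  "subalgebra scale A \<longleftrightarrow>
     module.subspace scale A \<and> 1 \<in> A \<and> (\<forall>a\<in>A. \<forall>b\<in>A. a * b \<in> A)"

definition alg_gen :: "('k::field \<Rightarrow> 'b::comm_ring_1 \<Rightarrow> 'b) \<Rightarrow> 'b set \<Rightarrow> 'b set" where
  "alg_gen scale S = \<Inter>{A. subalgebra scale A \<and> S \<subseteq> A}"


section \<open>Polynomials in several variables\<close>

text \<open>
  A polynomial is a finitely supported map from monomials to coefficients, a monomial being
  a finitely supported map from variables to exponents.  The variables are taken from a type
  which may be larger than wanted; \<open>mpoly_ring V\<close> is the ring of the polynomials in which only
  variables from \<open>V\<close> occur.
\<close>

type_synonym ('v, 'k) mpoly = "('v \<Rightarrow>\<^sub>0 nat) \<Rightarrow>\<^sub>0 'k"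

definition mpoly_ring :: "'v set \<Rightarrow> ('v, 'k::comm_ring_1) mpoly ring" where
  "mpoly_ring V =
     \<lparr>carrier = {p. \<forall>\<mu>\<in>Poly_Mapping.keys p. Poly_Mapping.keys \<mu> \<subseteq> V}, mult = (*), one = 1, zero = 0, add = (+)\<rparr>"

definition mvar :: "'v \<Rightarrow> ('v, 'k::comm_ring_1) mpoly" where
  "mvar v = Poly_Mapping.single (Poly_Mapping.single v 1) 1"

definition mconst :: "'k \<Rightarrow> ('v, 'k::comm_ring_1) mpoly" where
  "mconst c = Poly_Mapping.single 0 c"

definition peval ::
    "('k::comm_ring_1 \<Rightarrow> 'b::comm_ring_1 \<Rightarrow> 'b) \<Rightarrow> ('v \<Rightarrow> 'b) \<Rightarrow> ('v, 'k) mpoly \<Rightarrow> 'b" where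
  "peval scale a p =
     (\<Sum>\<mu>\<in>Poly_Mapping.keys p. scale (Poly_Mapping.lookup p \<mu>) (\<Prod>v\<in>Poly_Mapping.keys \<mu>. a v ^ Poly_Mapping.lookup \<mu> v))"

definition mweight :: "('v \<Rightarrow> nat) \<Rightarrow> ('v \<Rightarrow>\<^sub>0 nat) \<Rightarrow> nat" where
  "mweight w \<mu> = (\<Sum>v\<in>Poly_Mapping.keys \<mu>. w v * Poly_Mapping.lookup \<mu> v)"

definition homogeneous :: "('v \<Rightarrow> nat) \<Rightarrow> nat \<Rightarrow> ('v, 'k::comm_ring_1) mpoly \<Rightarrow> bool" where
  "homogeneous w i p \<longleftrightarrow> (\<forall>\<mu>\<in>Poly_Mapping.keys p. mweight w \<mu> = i)"

definition hcomp :: "('v \<Rightarrow> nat) \<Rightarrow> nat \<Rightarrow> ('v, 'k::comm_ring_1) mpoly \<Rightarrow> ('v, 'k) mpoly" where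
  "hcomp w i p =
     (\<Sum>\<mu>\<in>{\<mu>\<in>Poly_Mapping.keys p. mweight w \<mu> = i}. Poly_Mapping.single \<mu> (Poly_Mapping.lookup p \<mu>))"

text \<open>
  The weighted degree of \<open>p \<noteq> 0\<close> is \<open>Max (mweight w ` Poly_Mapping.keys p)\<close>.  For \<open>p = 0\<close> this maximum is
  unspecified, but every homogeneous component of \<open>0\<close> is \<open>0\<close>, so \<open>top_form w 0 = 0\<close>.
\<close>

definition top_form :: "('v \<Rightarrow> nat) \<Rightarrow> ('v, 'k::comm_ring_1) mpoly \<Rightarrow> ('v, 'k) mpoly" where
  "top_form w p = hcomp w (Max (mweight w ` Poly_Mapping.keys p)) p"


section \<open>Filtrations and associated graded algebras\<close>

text \<open>\<open>lower F i\<close> is $F_{i-1}$, with the convention $F_{-1} = 0$.\<close>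

definition lower :: "(nat \<Rightarrow> 'b::comm_ring_1 set) \<Rightarrow> nat \<Rightarrow> 'b set" where
  "lower F i = (case i of 0 \<Rightarrow> {0} | Suc j \<Rightarrow> F j)"

definition nfiltration ::
    "('k::field \<Rightarrow> 'b::comm_ring_1 \<Rightarrow> 'b) \<Rightarrow> (nat \<Rightarrow> 'b set) \<Rightarrow> bool" where
  "nfiltration scale F \<longleftrightarrow>
     (\<forall>i. module.subspace scale (F i)) \<and>
     (\<forall>i. F i \<subseteq> F (Suc i)) \<and>
     (\<Union>i. F i) = UNIV \<and>
     (\<forall>i j. \<forall>a\<in>F i. \<forall>b\<in>F j. a * b \<in> F (i + j))"

definition proper_nfiltration ::
    "('k::field \<Rightarrow> 'b::comm_ring_1 \<Rightarrow> 'b) \<Rightarrow> (nat \<Rightarrow> 'b set) \<Rightarrow> bool" where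
  "proper_nfiltration scale F \<longleftrightarrow>
     nfiltration scale F \<and>
     (\<forall>i j. \<forall>a \<in> F i - lower F i. \<forall>b \<in> F j - lower F j.
        a * b \<in> F (i + j) - lower F (i + j))"

text \<open>
  An element of $\bigoplus_i F_i/F_{i-1}$ is a function which maps every \<open>i\<close> to a coset of
  \<open>lower F i\<close>, for all but finitely many \<open>i\<close> to the zero coset.  Sums of cosets are sums of
  sets.  The product of the cosets \<open>a + lower F i\<close> and \<open>b + lower F j\<close> is obtained by adding
  \<open>lower F (i + j)\<close> to the set of all products of their elements, which is
  \<open>a * b + lower F (i + j)\<close> if \<open>F\<close> is a filtration, \<open>a \<in> F i\<close> and \<open>b \<in> F j\<close>.
\<close>

definition gr_incl :: "(nat \<Rightarrow> 'b::comm_ring_1 set) \<Rightarrow> nat \<Rightarrow> 'b \<Rightarrow> nat \<Rightarrow> 'b set" where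
  "gr_incl F i a = (\<lambda>j. if j = i then a +o lower F j else lower F j)"

definition assoc_graded :: "(nat \<Rightarrow> 'b::comm_ring_1 set) \<Rightarrow> (nat \<Rightarrow> 'b set) ring" where
  "assoc_graded F =
     \<lparr>carrier = {g. (\<forall>i. \<exists>a\<in>F i. g i = a +o lower F i) \<and> finite {i. g i \<noteq> lower F i}},
      mult = (\<lambda>g h i. \<Sum>j\<le>i. (g j * h (i - j) + lower F i)),
      one = gr_incl F 0 1,
      zero = (\<lambda>i. lower F i),
      add = (\<lambda>g h i. g i + h i)\<rparr>"


section \<open>Locally nilpotent derivations\<close>

definition derivation ::
    "('k::field \<Rightarrow> 'b::comm_ring_1 \<Rightarrow> 'b) \<Rightarrow> ('b \<Rightarrow> 'b) \<Rightarrow> bool" where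
  "derivation scale D \<longleftrightarrow>
     Vector_Spaces.linear scale scale D \<and> (\<forall>a b. D (a * b) = D a * b + a * D b)"

definition locally_nilpotent :: "('b::comm_ring_1 \<Rightarrow> 'b) \<Rightarrow> bool" where
  "locally_nilpotent D \<longleftrightarrow> (\<forall>a. \<exists>n. (D ^^ n) a = 0)"

definition der_deg :: "('b::comm_ring_1 \<Rightarrow> 'b) \<Rightarrow> 'b \<Rightarrow> ereal" where
  "der_deg D a =
     (if a = 0 then - \<infinity> else ereal (real (LEAST i. (D ^^ (i + 1)) a = 0)))"

definition der_filtration :: "('b::comm_ring_1 \<Rightarrow> 'b) \<Rightarrow> nat \<Rightarrow> 'b set" where
  "der_filtration D i = {a. (D ^^ (i + 1)) a = 0}"

definition der_ker :: "('b::comm_ring_1 \<Rightarrow> 'b) \<Rightarrow> 'b set" where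
  "der_ker D = {a. D a = 0}"


section \<open>The data attached to a locally nilpotent derivation\<close>

datatype var = ZVar nat | XVar nat | SVar nat

definition xvars :: "nat \<Rightarrow> var set" where
  "xvars n = XVar ` {1..n}"

definition zxsvars :: "nat \<Rightarrow> nat \<Rightarrow> nat \<Rightarrow> var set" where
  "zxsvars r n m = ZVar ` {1..r} \<union> XVar ` {1..n} \<union> SVar ` {1..m}"

text \<open>
  The value $p(x_1, \ldots, x_n)$ of a polynomial in the variables \<open>xvars n\<close>; the values
  given to the other variables are irrelevant.
\<close>

definition xeval ::
    "('k::comm_ring_1 \<Rightarrow> 'b::comm_ring_1 \<Rightarrow> 'b) \<Rightarrow> (nat \<Rightarrow> 'b) \<Rightarrow> (var, 'k) mpoly \<Rightarrow> 'b" where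
  "xeval scale x p = peval scale (case_var (\<lambda>_. 0) x (\<lambda>_. 0)) p"

text \<open>
  $B = k[X_1, \ldots, X_n]/I = k[x_1, \ldots, x_n]$: evaluation at $x_1, \ldots, x_n$ is a
  surjection of $k[X_1, \ldots, X_n]$ onto \<open>B\<close> with kernel \<open>I\<close>.
\<close>

definition presented_by ::
    "('k::field \<Rightarrow> 'b::comm_ring_1 \<Rightarrow> 'b) \<Rightarrow> nat \<Rightarrow> (nat \<Rightarrow> 'b) \<Rightarrow> (var, 'k) mpoly set \<Rightarrow> bool" where
  "presented_by scale n x I \<longleftrightarrow>
     xeval scale x ` carrier (mpoly_ring (xvars n)) = UNIV \<and>
     I = {p \<in> carrier (mpoly_ring (xvars n)). xeval scale x p = 0}"

definition H_part ::
    "('k::field \<Rightarrow> 'b::comm_ring_1 \<Rightarrow> 'b) \<Rightarrow> ('b \<Rightarrow> 'b) \<Rightarrow> nat \<Rightarrow> (nat \<Rightarrow> 'b) \<Rightarrow>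
      nat \<Rightarrow> (nat \<Rightarrow> 'b) \<Rightarrow> (nat \<Rightarrow> nat) \<Rightarrow> nat \<Rightarrow> 'b set" where
  "H_part scale D m s n x d j =
     module.span scale
       {a * ((\<Prod>l=1..m. s l ^ u l) * (\<Prod>i=1..n. x i ^ v i)) | a u v.
          a \<in> der_ker D \<and> (\<Sum>l=1..m. u l) + (\<Sum>i=1..n. d i * v i) = j}"

definition G_filtration ::
    "('k::field \<Rightarrow> 'b::comm_ring_1 \<Rightarrow> 'b) \<Rightarrow> ('b \<Rightarrow> 'b) \<Rightarrow> nat \<Rightarrow> (nat \<Rightarrow> 'b) \<Rightarrow>
      nat \<Rightarrow> (nat \<Rightarrow> 'b) \<Rightarrow> (nat \<Rightarrow> nat) \<Rightarrow> nat \<Rightarrow> 'b set" where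
  "G_filtration scale D m s n x d i = (\<Sum>j\<le>i. H_part scale D m s n x d j)"

definition omega_weight :: "(nat \<Rightarrow> nat) \<Rightarrow> var \<Rightarrow> nat" where
  "omega_weight d = case_var (\<lambda>_. 0) d (\<lambda>_. 1)"

definition J_ideal ::
    "nat \<Rightarrow> nat \<Rightarrow> nat \<Rightarrow> (var, 'k::field) mpoly set \<Rightarrow>
      (nat \<Rightarrow> (var, 'k) mpoly) \<Rightarrow> (nat \<Rightarrow> (var, 'k) mpoly) \<Rightarrow> (var, 'k) mpoly set" where
  "J_ideal r n m I zp sp =
     genideal (mpoly_ring (zxsvars r n m))
       (I \<union> (\<lambda>j. mvar (ZVar j) - zp j) ` {1..r} \<union> (\<lambda>l. mvar (SVar l) - sp l) ` {1..m})"

definition J_hat ::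
    "nat \<Rightarrow> nat \<Rightarrow> nat \<Rightarrow> (nat \<Rightarrow> nat) \<Rightarrow> (var, 'k::field) mpoly set \<Rightarrow>
      (nat \<Rightarrow> (var, 'k) mpoly) \<Rightarrow> (nat \<Rightarrow> (var, 'k) mpoly) \<Rightarrow> (var, 'k) mpoly set" where
  "J_hat r n m d I zp sp =
     genideal (mpoly_ring (zxsvars r n m))
       (top_form (omega_weight d) ` J_ideal r n m I zp sp)"

text \<open>
  An isomorphism of graded \<open>k\<close>-algebras: the structure maps of the algebras \<open>A\<close> and \<open>B\<close> are
  \<open>\<iota>A\<close> and \<open>\<iota>B\<close>, their components of degree \<open>i\<close> are \<open>A' i\<close> and \<open>B' i\<close>.
\<close>

definition graded_alg_iso ::
    "'a ring \<Rightarrow> ('k \<Rightarrow> 'a) \<Rightarrow> (nat \<Rightarrow> 'a set) \<Rightarrow> 'c ring \<Rightarrow> ('k \<Rightarrow> 'c) \<Rightarrow> (nat \<Rightarrow> 'c set) \<Rightarrow>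
      ('a \<Rightarrow> 'c) \<Rightarrow> bool" where
  "graded_alg_iso A \<iota>A A' B \<iota>B B' \<phi> \<longleftrightarrow>
     \<phi> \<in> ring_iso A B \<and> (\<forall>c. \<phi> (\<iota>A c) = \<iota>B c) \<and> (\<forall>i. \<phi> ` A' i = B' i)"

end

theory Submission
  imports Defs
begin

text \<open>
  Write \<open>F\<close> for the filtration of the derivation \<open>D\<close>, \<open>G\<close> for the filtration generated by the
  \<open>s l\<close> and \<open>x i\<close> over the kernel of \<open>D\<close>, and let \<open>W i\<close> be the image in \<open>B\<close> of the polynomials of
  weight at most \<open>i\<close> in the variables \<open>Z\<close>, \<open>X\<close>, \<open>S\<close>.  The proof has two independent halves.

  The first half shows that the three filtrations agree.  The kernel of \<open>D\<close> is generated by the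
  \<open>z j\<close>, so \<open>G i \<subseteq> W i\<close>; every variable is sent to an element whose degree is at most its weight,
  so \<open>W i \<subseteq> F i\<close>.  Only \<open>F i \<subseteq> G i\<close> needs properness.  Since \<open>s 1\<close> is a local slice, \<open>B\<close> becomes
  a polynomial ring in \<open>s 1\<close> over the kernel once \<open>D (s 1)\<close> is inverted.  Clearing denominators,
  every \<open>b \<in> F i\<close> has a multiple \<open>e * b\<close>, with \<open>e \<noteq> 0\<close> in the kernel, that is a polynomial of degree
  at most \<open>i\<close> in \<open>s 1\<close> over the kernel, hence lies in \<open>G i\<close>
  (\<open>kernel_multiple_mem_filtration\<close>).  But \<open>e\<close> has degree \<open>0\<close> for \<open>G\<close>, and degrees add for a
  proper filtration, so \<open>b\<close> itself lies in \<open>G i\<close> (\<open>F_subset_proper_filtration\<close>).  If there is no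
  local slice at all, then \<open>D = 0\<close> and all filtrations are trivial.

  The second half holds for any filtration that is the image of the weight filtration of a
  polynomial ring (\<open>assoc_graded_iso\<close>).  Sending a homogeneous polynomial of weight \<open>i\<close> to the class
  of its value modulo \<open>lower F i\<close> defines a surjective ring homomorphism onto the associated graded
  ring.  A homogeneous polynomial \<open>p\<close> of weight \<open>i\<close> is in its kernel iff its value is also the value
  of a polynomial \<open>q\<close> of smaller weight; then \<open>p\<close> is the top form of the relation \<open>p - q\<close>.  So the
  kernel is generated by the top forms of all relations.  What remains is that \<open>J\<close> is the
  ideal of all relations (\<open>J_ideal_eq_kernel\<close>).
\<close>

section \<open>Polynomials and their evaluation\<close>

abbreviation lookup where "lookup \<equiv> Poly_Mapping.lookup"
abbreviation keys where "keys \<equiv> Poly_Mapping.keys"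
abbreviation single where "single \<equiv> Poly_Mapping.single"

lemma mem_carrier_mpoly_ring:
  "p \<in> carrier (mpoly_ring V) \<longleftrightarrow> (\<forall>\<mu>\<in>keys p. keys \<mu> \<subseteq> V)"
  by (simp add: mpoly_ring_def)

lemma mpoly_ring_simps [simp]:
  "mult (mpoly_ring V) = (*)" "one (mpoly_ring V) = 1"
  "zero (mpoly_ring V) = 0" "add (mpoly_ring V) = (+)"
  by (simp_all add: mpoly_ring_def)

lemma mpoly_ring_closed:
  shows add_mem_mpoly_ring: "p \<in> carrier (mpoly_ring V) \<Longrightarrow> q \<in> carrier (mpoly_ring V) \<Longrightarrow> p + q \<in> carrier (mpoly_ring V)"
    and mult_mem_mpoly_ring: "p \<in> carrier (mpoly_ring V) \<Longrightarrow> q \<in> carrier (mpoly_ring V) \<Longrightarrow> p * q \<in> carrier (mpoly_ring V)"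
    and uminus_mem_mpoly_ring: "p \<in> carrier (mpoly_ring V) \<Longrightarrow> - p \<in> carrier (mpoly_ring V)"
    and minus_mem_mpoly_ring: "p \<in> carrier (mpoly_ring V) \<Longrightarrow> q \<in> carrier (mpoly_ring V) \<Longrightarrow> p - q \<in> carrier (mpoly_ring V)"
    and zero_mem_mpoly_ring: "0 \<in> carrier (mpoly_ring V)"
    and one_mem_mpoly_ring: "1 \<in> carrier (mpoly_ring V)"
    and mconst_mem_mpoly_ring: "mconst c \<in> carrier (mpoly_ring V)"
    and mvar_mem_mpoly_ring: "v \<in> V \<Longrightarrow> mvar v \<in> carrier (mpoly_ring V)"
    and single_mem_mpoly_ring: "keys \<mu> \<subseteq> V \<Longrightarrow> single \<mu> c \<in> carrier (mpoly_ring V)"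
proof -
  have add: "p + q \<in> carrier (mpoly_ring V)"
    if "p \<in> carrier (mpoly_ring V)" "q \<in> carrier (mpoly_ring V)" for p q :: "('a, 'b) mpoly"
    using that Poly_Mapping.keys_add[of p q] by (fastforce simp: mem_carrier_mpoly_ring)
  have um: "- p \<in> carrier (mpoly_ring V)"
    if "p \<in> carrier (mpoly_ring V)" for p :: "('a, 'b) mpoly"
    using that by (simp add: mem_carrier_mpoly_ring in_keys_iff)
  show "p \<in> carrier (mpoly_ring V) \<Longrightarrow> q \<in> carrier (mpoly_ring V) \<Longrightarrow> p + q \<in> carrier (mpoly_ring V)"
    by (rule add)
  show "p \<in> carrier (mpoly_ring V) \<Longrightarrow> - p \<in> carrier (mpoly_ring V)"
    by (rule um)
  show "p \<in> carrier (mpoly_ring V) \<Longrightarrow> q \<in> carrier (mpoly_ring V) \<Longrightarrow> p - q \<in> carrier (mpoly_ring V)"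
    using add[of p "- q"] um[of q] by simp
  show "p * q \<in> carrier (mpoly_ring V)"
    if "p \<in> carrier (mpoly_ring V)" "q \<in> carrier (mpoly_ring V)"
  proof -
    have "keys \<mu> \<subseteq> V" if "\<mu> \<in> keys (p * q)" for \<mu>
    proof -
      obtain \<alpha> \<beta> where "\<mu> = \<alpha> + \<beta>" "\<alpha> \<in> keys p" "\<beta> \<in> keys q"
        using Poly_Mapping.keys_mult[of p q] \<open>\<mu> \<in> keys (p * q)\<close> by blast
      then show ?thesis
        using \<open>p \<in> _\<close> \<open>q \<in> _\<close> Poly_Mapping.keys_add[of \<alpha> \<beta>]
        by (fastforce simp: mem_carrier_mpoly_ring)
    qed
    then show ?thesis by (simp add: mem_carrier_mpoly_ring)
  qed
qed (auto simp: mem_carrier_mpoly_ring mconst_def mvar_def split: if_splits)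

lemma cring_mpoly_ring: "cring (mpoly_ring V)"
proof (intro cringI abelian_groupI comm_monoidI)
  fix p assume "p \<in> carrier (mpoly_ring V)"
  then show "\<exists>q\<in>carrier (mpoly_ring V). q \<oplus>\<^bsub>mpoly_ring V\<^esub> p = \<zero>\<^bsub>mpoly_ring V\<^esub>"
    using uminus_mem_mpoly_ring[of p V] by (intro bexI[of _ "- p"]) auto
qed (auto simp: mpoly_ring_closed algebra_simps)

lemma a_inv_mpoly_ring:
  assumes "p \<in> carrier (mpoly_ring V)"
  shows "\<ominus>\<^bsub>mpoly_ring V\<^esub> p = - p"
proof -
  interpret cring "mpoly_ring V" by (rule cring_mpoly_ring)
  show ?thesis
    using minus_equality[of "- p" p] assms uminus_mem_mpoly_ring[OF assms] by simp
qed

lemma sum_monomials: "(\<Sum>\<mu>\<in>keys p. single \<mu> (lookup p \<mu>)) = p"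
proof (rule poly_mapping_eqI)
  fix k
  have "(\<Sum>\<mu>\<in>keys p. lookup p \<mu> when \<mu> = k) = lookup p k"
    by (simp add: when_def in_keys_iff)
  then show "lookup (\<Sum>\<mu>\<in>keys p. single \<mu> (lookup p \<mu>)) k = lookup p k"
    by (simp add: lookup_sum lookup_single)
qed

lemma mpoly_monomial_induct [consumes 1, case_names monomial add]:
  assumes "p \<in> carrier (mpoly_ring V)"
    and monomial: "\<And>\<mu> c. keys \<mu> \<subseteq> V \<Longrightarrow> P (single \<mu> c)"
    and add: "\<And>p q. p \<in> carrier (mpoly_ring V) \<Longrightarrow> q \<in> carrier (mpoly_ring V) \<Longrightarrow>
      P p \<Longrightarrow> P q \<Longrightarrow> P (p + q)"
  shows "P p"
proof -
  have "P (\<Sum>\<mu>\<in>M. single \<mu> (lookup p \<mu>)) \<and> (\<Sum>\<mu>\<in>M. single \<mu> (lookup p \<mu>)) \<in> carrier (mpoly_ring V)"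
    if "finite M" "M \<subseteq> keys p" for M
    using that
  proof induction
    case empty
    have "P (single 0 0)" by (rule monomial) simp
    then show ?case by (simp add: zero_mem_mpoly_ring)
  next
    case (insert \<mu> M)
    have "keys \<mu> \<subseteq> V"
      using insert assms(1) by (auto simp: mem_carrier_mpoly_ring)
    then show ?case
      using insert by (simp add: add monomial mpoly_ring_closed)
  qed
  from this[of "keys p"] show ?thesis by (simp add: sum_monomials)
qed

lemma mem_mpoly_ring_UNIV: "p \<in> carrier (mpoly_ring UNIV)"
  by (simp add: mem_carrier_mpoly_ring)

lemma mpoly_ring_induct [consumes 1, case_names const var add mult]:
  assumes "p \<in> carrier (mpoly_ring V)"
    and const: "\<And>c. P (mconst c)"
    and var: "\<And>v. v \<in> V \<Longrightarrow> P (mvar v)"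
    and add: "\<And>p q. p \<in> carrier (mpoly_ring V) \<Longrightarrow> q \<in> carrier (mpoly_ring V) \<Longrightarrow>
      P p \<Longrightarrow> P q \<Longrightarrow> P (p + q)"
    and mult: "\<And>p q. p \<in> carrier (mpoly_ring V) \<Longrightarrow> q \<in> carrier (mpoly_ring V) \<Longrightarrow>
      P p \<Longrightarrow> P q \<Longrightarrow> P (p * q)"
  shows "P p"
  using assms(1)
proof (induction rule: mpoly_monomial_induct)
  case (monomial \<mu> c)
  have power: "P (single (single v k) 1)" if "v \<in> V" for v and k :: nat
  proof (induction k)
    case 0
    show ?case using const[of 1] by (simp add: mconst_def)
  next
    case (Suc k)
    have eq: "single (single v (Suc k)) 1 = mvar v * single (single v k) 1"
      by (simp add: mvar_def mult_single single_add[symmetric])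
    show ?case
      unfolding eq using Suc that
      by (intro mult var) (auto simp: mvar_mem_mpoly_ring single_mem_mpoly_ring)
  qed
  have "P (single (\<Sum>v\<in>M. single v (lookup \<mu> v)) c)" if "finite M" "M \<subseteq> V" for M
    using that
  proof induction
    case empty
    show ?case using const[of c] by (simp add: mconst_def)
  next
    case (insert v M)
    have "keys (\<Sum>u\<in>M. single u (lookup \<mu> u)) \<subseteq> M"
      using keys_sum[of "\<lambda>u. single u (lookup \<mu> u)" M] by (auto split: if_splits)
    then have "P (single (single v (lookup \<mu> v)) 1 * single (\<Sum>u\<in>M. single u (lookup \<mu> u)) c)"
      using insert by (intro mult power) (auto intro!: single_mem_mpoly_ring split: if_splits)
    then show ?case using insert by (simp add: mult_single)
  qed
  from this[of "keys \<mu>"] monomial show ?case by (simp add: sum_monomials)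
qed (rule add)

context k_algebra
begin

lemma scale_mult_scale: "scale c a * scale e b = scale (c * e) (a * b)"
  by (metis mult.commute scale_mult_left scale_scale)

lemma scale_eq_mult: "scale c a = scale c 1 * a"
  by (metis mult_1 scale_mult_left)

lemma peval_superset:
  assumes "finite M" "keys p \<subseteq> M"
  shows "peval scale a p = (\<Sum>\<mu>\<in>M. scale (lookup p \<mu>) (\<Prod>v\<in>keys \<mu>. a v ^ lookup \<mu> v))"
  unfolding peval_def using assms
  by (intro sum.mono_neutral_left) (auto simp: in_keys_iff)

lemma peval_add: "peval scale a (p + q) = peval scale a p + peval scale a q"
proof -
  let ?M = "keys p \<union> keys q"
  show ?thesis
    using peval_superset[of ?M "p + q"] peval_superset[of ?M p] peval_superset[of ?M q]
      Poly_Mapping.keys_add[of p q]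
    by (simp add: lookup_add scale_left_distrib sum.distrib)
qed

lemma peval_single:
  "peval scale a (single \<mu> c) = scale c (\<Prod>v\<in>keys \<mu>. a v ^ lookup \<mu> v)"
  using peval_superset[of "{\<mu>}" "single \<mu> c" a] by (simp split: if_splits)

lemma peval_mconst: "peval scale a (mconst c) = scale c 1"
  by (simp add: mconst_def peval_single)

lemma peval_zero [simp]: "peval scale a 0 = 0"
  by (simp add: peval_def)

lemma peval_mvar: "peval scale a (mvar v) = a v"
  by (simp add: mvar_def peval_single)

lemma peval_uminus: "peval scale a (- p) = - peval scale a p"
  using peval_add[of a p "- p"] by (simp add: eq_neg_iff_add_eq_0 add.commute)

lemma peval_diff: "peval scale a (p - q) = peval scale a p - peval scale a q"
  using peval_add[of a p "- q"] by (simp add: peval_uminus)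

lemma peval_sum: "peval scale a (\<Sum>i\<in>A. f i) = (\<Sum>i\<in>A. peval scale a (f i))"
  by (induction A rule: infinite_finite_induct) (simp_all add: peval_add)

lemma monomial_value_add:
  fixes \<mu> \<nu> :: "'v \<Rightarrow>\<^sub>0 nat" and a :: "'v \<Rightarrow> 'c::comm_monoid_mult"
  shows "(\<Prod>v\<in>keys (\<mu> + \<nu>). a v ^ lookup (\<mu> + \<nu>) v) =
    (\<Prod>v\<in>keys \<mu>. a v ^ lookup \<mu> v) * (\<Prod>v\<in>keys \<nu>. a v ^ lookup \<nu> v)"
proof -
  let ?M = "keys \<mu> \<union> keys \<nu>"
  have *: "(\<Prod>v\<in>keys \<xi>. a v ^ lookup \<xi> v) = (\<Prod>v\<in>?M. a v ^ lookup \<xi> v)"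
    if "keys \<xi> \<subseteq> ?M" for \<xi>
    using that by (intro prod.mono_neutral_left) (auto simp: in_keys_iff)
  show ?thesis
    using *[OF Poly_Mapping.keys_add] *[of \<mu>] *[of \<nu>]
    by (simp add: lookup_add power_add prod.distrib)
qed

lemma peval_mult: "peval scale a (p * q) = peval scale a p * peval scale a q"
  using mem_mpoly_ring_UNIV[of p]
proof (induction rule: mpoly_monomial_induct)
  case (monomial \<mu> c)
  show ?case
    using mem_mpoly_ring_UNIV[of q]
  proof (induction rule: mpoly_monomial_induct)
    case (monomial \<nu> e)
    show ?case
      by (simp add: mult_single peval_single monomial_value_add scale_mult_scale)
  qed (simp add: peval_add distrib_left)
qed (simp add: peval_add distrib_right)

lemma peval_cong:
  assumes "p \<in> carrier (mpoly_ring V)" "\<And>v. v \<in> V \<Longrightarrow> a v = b v"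
  shows "peval scale a p = peval scale b p"
  unfolding peval_def using assms
  by (intro sum.cong arg_cong2[of _ _ _ _ scale] prod.cong refl)
    (auto simp: mem_carrier_mpoly_ring subset_eq)

end

section \<open>Weights and homogeneous components\<close>

lemma mweight_add: "mweight w (\<mu> + \<nu>) = mweight w \<mu> + mweight w \<nu>"
proof -
  let ?M = "keys \<mu> \<union> keys \<nu>"
  have *: "mweight w \<xi> = (\<Sum>v\<in>?M. w v * lookup \<xi> v)" if "keys \<xi> \<subseteq> ?M" for \<xi>
    unfolding mweight_def using that by (intro sum.mono_neutral_left) (auto simp: in_keys_iff)
  show ?thesis
    using *[OF Poly_Mapping.keys_add] *[of \<mu>] *[of \<nu>]
    by (simp add: lookup_add distrib_left sum.distrib)
qed

lemma mweight_zero [simp]: "mweight w 0 = 0"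
  by (simp add: mweight_def)

lemma mweight_single: "mweight w (single v k) = w v * k"
  by (simp add: mweight_def)

lemma lookup_hcomp: "lookup (hcomp w i p) \<mu> = (if mweight w \<mu> = i then lookup p \<mu> else 0)"
proof -
  have "lookup (hcomp w i p) \<mu> =
      (\<Sum>\<nu>\<in>{\<nu>\<in>keys p. mweight w \<nu> = i}. if \<nu> = \<mu> then lookup p \<nu> else 0)"
    by (simp add: hcomp_def lookup_sum lookup_single when_def)
  also have "\<dots> = (if mweight w \<mu> = i then lookup p \<mu> else 0)"
    by (subst sum.delta) (auto simp: in_keys_iff)
  finally show ?thesis .
qed

lemma keys_hcomp: "keys (hcomp w i p) = {\<mu> \<in> keys p. mweight w \<mu> = i}"
  by (auto simp: in_keys_iff lookup_hcomp split: if_splits)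

lemma hcomp_mem_mpoly_ring:
  "p \<in> carrier (mpoly_ring V) \<Longrightarrow> hcomp w i p \<in> carrier (mpoly_ring V)"
  by (simp add: mem_carrier_mpoly_ring keys_hcomp)

lemma hcomp_add: "hcomp w i (p + q) = hcomp w i p + hcomp w i q"
  by (rule poly_mapping_eqI) (simp add: lookup_hcomp lookup_add)

lemma hcomp_single: "hcomp w i (single \<mu> c) = (if mweight w \<mu> = i then single \<mu> c else 0)"
  by (rule poly_mapping_eqI) (auto simp: lookup_hcomp lookup_single when_def)

lemma homogeneous_hcomp: "homogeneous w i (hcomp w i p)"
  by (simp add: homogeneous_def keys_hcomp)

lemma hcomp_homogeneous: "homogeneous w i p \<Longrightarrow> hcomp w j p = (if j = i then p else 0)"
  by (rule poly_mapping_eqI) (auto simp: lookup_hcomp homogeneous_def in_keys_iff)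

lemma hcomp_mult: "hcomp w i (p * q) = (\<Sum>j\<le>i. hcomp w j p * hcomp w (i - j) q)"
  using mem_mpoly_ring_UNIV[of p]
proof (induction rule: mpoly_monomial_induct)
  case (monomial \<mu> c)
  show ?case
    using mem_mpoly_ring_UNIV[of q]
  proof (induction rule: mpoly_monomial_induct)
    case (monomial \<nu> e)
    have "(\<Sum>j\<le>i. hcomp w j (single \<mu> c) * hcomp w (i - j) (single \<nu> e)) =
        (\<Sum>j\<le>i. if mweight w \<mu> = j then
          (if mweight w \<nu> = i - mweight w \<mu> then single \<mu> c * single \<nu> e else 0) else 0)"
      by (intro sum.cong) (auto simp: hcomp_single)
    also have "\<dots> = hcomp w i (single \<mu> c * single \<nu> e)"
      by (auto simp: mult_single hcomp_single mweight_add)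
    finally show ?case by simp
  qed (simp add: hcomp_add distrib_left sum.distrib)
qed (simp add: hcomp_add distrib_right sum.distrib)

lemma sum_hcomp:
  assumes "finite A" "mweight w ` keys p \<subseteq> A"
  shows "(\<Sum>i\<in>A. hcomp w i p) = p"
proof (rule poly_mapping_eqI)
  fix \<mu>
  have "lookup p \<mu> = 0" if "mweight w \<mu> \<notin> A"
    using assms that by (metis image_subset_iff in_keys_iff)
  then show "lookup (\<Sum>i\<in>A. hcomp w i p) \<mu> = lookup p \<mu>"
    using assms by (auto simp: lookup_sum lookup_hcomp)
qed

section \<open>Images of polynomials of bounded weight\<close>

text \<open>
  In the application the variables are \<open>Z\<close>, \<open>X\<close>, \<open>S\<close>; as \<open>i\<close> varies these images form a filtration
  that lies between the two filtrations to be compared.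
\<close>

definition weighted_image ::
    "('k::field \<Rightarrow> 'b::comm_ring_1 \<Rightarrow> 'b) \<Rightarrow> 'v set \<Rightarrow> ('v \<Rightarrow> nat) \<Rightarrow> ('v \<Rightarrow> 'b) \<Rightarrow> nat \<Rightarrow> 'b set" where
  "weighted_image scale V w a i = peval scale a `
     {p \<in> carrier (mpoly_ring V). \<forall>\<mu>\<in>keys p. mweight w \<mu> \<le> i}"

context k_algebra
begin

lemma weighted_imageI:
  assumes "p \<in> carrier (mpoly_ring V)" "\<And>\<mu>. \<mu> \<in> keys p \<Longrightarrow> mweight w \<mu> \<le> i" "b = peval scale a p"
  shows "b \<in> weighted_image scale V w a i"
  unfolding weighted_image_def using assms by blast

lemma weighted_imageE:
  assumes "b \<in> weighted_image scale V w a i"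
  obtains p where "p \<in> carrier (mpoly_ring V)" "\<forall>\<mu>\<in>keys p. mweight w \<mu> \<le> i"
    "b = peval scale a p"
  using assms unfolding weighted_image_def by blast

lemma weighted_image_mono:
  "i \<le> j \<Longrightarrow> weighted_image scale V w a i \<subseteq> weighted_image scale V w a j"
  unfolding weighted_image_def by fastforce

lemma weighted_image_mult:
  assumes "b \<in> weighted_image scale V w a i" "c \<in> weighted_image scale V w a j"
  shows "b * c \<in> weighted_image scale V w a (i + j)"
proof -
  obtain p where p: "p \<in> carrier (mpoly_ring V)" "\<forall>\<mu>\<in>keys p. mweight w \<mu> \<le> i"
      "b = peval scale a p"
    using assms(1) by (rule weighted_imageE)
  obtain q where q: "q \<in> carrier (mpoly_ring V)" "\<forall>\<mu>\<in>keys q. mweight w \<mu> \<le> j"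
      "c = peval scale a q"
    using assms(2) by (rule weighted_imageE)
  have "mweight w \<mu> \<le> i + j" if "\<mu> \<in> keys (p * q)" for \<mu>
  proof -
    obtain \<alpha> \<beta> where "\<mu> = \<alpha> + \<beta>" "\<alpha> \<in> keys p" "\<beta> \<in> keys q"
      using Poly_Mapping.keys_mult[of p q] \<open>\<mu> \<in> keys (p * q)\<close> by blast
    then show ?thesis using p(2) q(2) by (auto simp: mweight_add intro!: add_mono)
  qed
  then show ?thesis
    using p q by (intro weighted_imageI[of "p * q"]) (auto simp: mult_mem_mpoly_ring peval_mult)
qed

lemma weighted_image_const: "scale c 1 \<in> weighted_image scale V w a 0"
  by (rule weighted_imageI[of "mconst c"])
    (simp_all add: mconst_mem_mpoly_ring peval_mconst, simp add: mconst_def split: if_splits)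

lemma weighted_image_one: "1 \<in> weighted_image scale V w a 0"
  using weighted_image_const[of 1] by simp

lemma weighted_image_var: "v \<in> V \<Longrightarrow> a v \<in> weighted_image scale V w a (w v)"
  by (rule weighted_imageI[of "mvar v"])
    (simp_all add: mvar_mem_mpoly_ring peval_mvar, simp add: mvar_def mweight_single split: if_splits)

lemma subspace_weighted_image: "subspace (weighted_image scale V w a i)"
proof (rule subspaceI)
  show "0 \<in> weighted_image scale V w a i"
    by (rule weighted_imageI[of 0]) (simp_all add: zero_mem_mpoly_ring)
next
  fix b c assume b: "b \<in> weighted_image scale V w a i" and c: "c \<in> weighted_image scale V w a i"
  obtain p where p: "p \<in> carrier (mpoly_ring V)" "\<forall>\<mu>\<in>keys p. mweight w \<mu> \<le> i"
      "b = peval scale a p"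
    using b by (rule weighted_imageE)
  obtain q where q: "q \<in> carrier (mpoly_ring V)" "\<forall>\<mu>\<in>keys q. mweight w \<mu> \<le> i"
      "c = peval scale a q"
    using c by (rule weighted_imageE)
  show "b + c \<in> weighted_image scale V w a i"
  proof (rule weighted_imageI[of "p + q"])
    fix \<mu> assume "\<mu> \<in> keys (p + q)"
    then show "mweight w \<mu> \<le> i"
      using Poly_Mapping.keys_add[of p q] p(2) q(2) by blast
  qed (simp_all add: p q add_mem_mpoly_ring peval_add)
next
  fix c b assume "b \<in> weighted_image scale V w a i"
  then show "scale c b \<in> weighted_image scale V w a i"
    using weighted_image_mult[OF weighted_image_const] scale_eq_mult[of c b] by fastforce
qed

lemma nfiltration_power:
  assumes "nfiltration scale F" "1 \<in> F 0" "b \<in> F i"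
  shows "b ^ k \<in> F (i * k)"
proof (induction k)
  case (Suc k)
  then have "b * b ^ k \<in> F (i + i * k)"
    using assms(1,3) unfolding nfiltration_def by blast
  then show ?case by simp
qed (simp add: assms)

lemma nfiltration_prod:
  assumes F: "nfiltration scale F" "1 \<in> F 0" and "finite A" "\<And>v. v \<in> A \<Longrightarrow> f v \<in> F (g v)"
  shows "(\<Prod>v\<in>A. f v) \<in> F (\<Sum>v\<in>A. g v)"
  using assms(3,4)
proof (induction A)
  case (insert v A)
  then have "f v \<in> F (g v)" "prod f A \<in> F (sum g A)" by auto
  then have "f v * prod f A \<in> F (g v + sum g A)"
    using F(1) unfolding nfiltration_def by blast
  then show ?case using insert by simp
qed (simp add: F)

lemma nfiltration_mono:
  assumes "nfiltration scale F" "i \<le> j"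
  shows "F i \<subseteq> F j"
  using assms(1) by (intro lift_Suc_mono_le[OF _ assms(2)]) (auto simp: nfiltration_def)

text \<open>
  The value of a monomial of weight \<open>j\<close> is a product of elements whose prescribed degrees add up
  to \<open>j\<close>, so it lies in \<open>F j\<close> as soon as each \<open>a v\<close> lies in \<open>F (w v)\<close>.
\<close>

lemma weighted_image_subset:
  assumes F: "nfiltration scale F" "1 \<in> F 0" and var: "\<And>v. v \<in> V \<Longrightarrow> a v \<in> F (w v)"
  shows "weighted_image scale V w a i \<subseteq> F i"
proof
  fix b assume "b \<in> weighted_image scale V w a i"
  then obtain p where p: "p \<in> carrier (mpoly_ring V)" "\<forall>\<mu>\<in>keys p. mweight w \<mu> \<le> i"
      "b = peval scale a p"
    by (rule weighted_imageE)
  have sub: "subspace (F i)" using F(1) by (simp add: nfiltration_def)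
  show "b \<in> F i"
    unfolding p(3) peval_def
  proof (intro subspace_sum[OF sub] subspace_scale[OF sub])
    fix \<mu> assume \<mu>: "\<mu> \<in> keys p"
    then have "(\<Prod>v\<in>keys \<mu>. a v ^ lookup \<mu> v) \<in> F (mweight w \<mu>)"
      unfolding mweight_def using p(1)
      by (intro nfiltration_prod[OF F] nfiltration_power[OF F] var)
        (auto simp: mem_carrier_mpoly_ring)
    then show "(\<Prod>v\<in>keys \<mu>. a v ^ lookup \<mu> v) \<in> F i"
      using nfiltration_mono[OF F(1) bspec[OF p(2) \<mu>]] by blast
  qed
qed

end

section \<open>Associated graded rings of weighted presentations\<close>

context k_algebra
begin

lemma subspace_lower: "nfiltration scale F \<Longrightarrow> subspace (lower F i)"
  by (simp add: lower_def nfiltration_def subspace_0 split: nat.split)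

lemma lower_subset: "nfiltration scale F \<Longrightarrow> lower F i \<subseteq> F i"
  by (auto simp: lower_def nfiltration_def subspace_0 split: nat.split)

lemma mult_mem_lower:
  assumes "nfiltration scale F" "a \<in> F i" "b \<in> lower F j"
  shows "a * b \<in> lower F (i + j)"
proof (cases j)
  case 0
  then show ?thesis using assms subspace_0[OF subspace_lower[OF assms(1)]] by (simp add: lower_def)
next
  case (Suc k)
  then show ?thesis using assms by (auto simp: lower_def nfiltration_def)
qed

lemma coset_eq_iff:
  assumes "subspace L"
  shows "a +o L = b +o L \<longleftrightarrow> a - b \<in> L"
proof
  assume "a +o L = b +o L"
  then show "a - b \<in> L"
    using set_plus_intro2[OF subspace_0[OF assms], of a] by (simp add: set_minus_plus)
next
  assume ab: "a - b \<in> L"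
  have "y - a \<in> L \<longleftrightarrow> y - b \<in> L" for y
    using subspace_add[OF assms ab, of "y - a"] subspace_diff[OF assms _ ab, of "y - b"] by auto
  then show "a +o L = b +o L"
    by (simp add: set_minus_plus[symmetric] set_eq_iff)
qed

lemma coset_eq_self_iff:
  assumes "subspace L"
  shows "a +o L = L \<longleftrightarrow> a \<in> L"
  using coset_eq_iff[OF assms, of a 0] by simp

lemma subspace_add_self:
  assumes "subspace L"
  shows "L + L = L"
  using subspace_add[OF assms] set_zero_plus2[OF subspace_0[OF assms], of L]
  by (auto simp: set_plus_def)

lemma coset_add:
  assumes "subspace L"
  shows "(a +o L) + (b +o L) = (a + b) +o L"
  by (simp add: set_plus_rearrange subspace_add_self[OF assms])

lemma sum_coset:
  assumes "subspace L" "finite A" "A \<noteq> {}"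
  shows "(\<Sum>j\<in>A. f j +o L) = (\<Sum>j\<in>A. f j) +o L"
  using assms(2,3) by (induction rule: finite_ne_induct) (simp_all add: coset_add[OF assms(1)])

text \<open>
  The set of products of elements of two cosets need not be a full coset; adding
  \<open>lower F (i + j)\<close> completes it to one.  The choice of representatives does not matter because
  \<open>x * y - a * b = y * (x - a) + a * (y - b)\<close>, where both summands have dropped in degree.
\<close>

lemma coset_mult:
  assumes F: "nfiltration scale F" and a: "a \<in> F i" and b: "b \<in> F j"
  shows "(a +o lower F i) * (b +o lower F j) + lower F (i + j) = a * b +o lower F (i + j)"
proof -
  let ?L = "lower F (i + j)"
  note L = subspace_lower[OF F, of "i + j"]
  have prod: "x * y - a * b \<in> ?L" if "x - a \<in> lower F i" "y - b \<in> lower F j" for x y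
  proof -
    have "y - b + b \<in> F j"
      using that b lower_subset[OF F, of j] F by (intro subspace_add) (auto simp: nfiltration_def)
    then have "y * (x - a) \<in> lower F (j + i)"
      using that by (intro mult_mem_lower[OF F]) auto
    moreover have "a * (y - b) \<in> ?L"
      using that a by (intro mult_mem_lower[OF F])
    ultimately have "y * (x - a) + a * (y - b) \<in> ?L"
      by (intro subspace_add[OF L]) (simp_all add: add.commute)
    then show ?thesis by (simp add: algebra_simps)
  qed
  show ?thesis
  proof (intro subset_antisym subsetI)
    fix t assume "t \<in> (a +o lower F i) * (b +o lower F j) + ?L"
    then obtain x y l where t: "t = x * y + l" and xy: "x \<in> a +o lower F i" "y \<in> b +o lower F j"
      and l: "l \<in> ?L"
      by (auto simp: set_plus_def set_times_def)
    have "x * y - a * b + l \<in> ?L"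
      using prod xy l by (intro subspace_add[OF L]) (simp_all add: set_minus_plus)
    then show "t \<in> a * b +o ?L"
      by (simp add: set_minus_plus[symmetric] t algebra_simps)
  next
    fix t assume "t \<in> a * b +o ?L"
    moreover have "a \<in> a +o lower F i" "b \<in> b +o lower F j"
      using subspace_0[OF subspace_lower[OF F]] by (simp_all add: set_minus_plus[symmetric])
    ultimately show "t \<in> (a +o lower F i) * (b +o lower F j) + ?L"
      by (auto simp: elt_set_plus_def[of "a * b"] intro!: set_plus_intro set_times_intro)
  qed
qed

end

text \<open>
  A filtration that is the image of the weight filtration of a polynomial ring.  The polynomial
  ring is graded, so it is its own associated graded ring, and the evaluation induces a surjection
  from it onto the associated graded ring of \<open>F\<close>.
\<close>

locale weighted_presentation = k_algebra scale
  for scale :: "'k::field \<Rightarrow> 'b::comm_ring_1 \<Rightarrow> 'b" +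
  fixes V :: "'v set" and w :: "'v \<Rightarrow> nat" and a :: "'v \<Rightarrow> 'b" and F :: "nat \<Rightarrow> 'b set"
  assumes filtration: "nfiltration scale F"
    and F_weighted_image: "F i = weighted_image scale V w a i"
begin

lemmas F_image = F_weighted_image[unfolded weighted_image_def]

abbreviation "P \<equiv> mpoly_ring V :: ('v, 'k) mpoly ring"

text \<open>
  The induced map from the polynomial ring to the associated graded ring.  Each component of \<open>p\<close> is
  evaluated modulo the next lower step of \<open>F\<close>, even if its value happens to lie there; this makes
  the map additive and multiplicative, which the leading class of the value of \<open>p\<close> in general is not.
\<close>

definition symbol :: "('v, 'k) mpoly \<Rightarrow> nat \<Rightarrow> 'b set" where
  "symbol p = (\<lambda>i. peval scale a (hcomp w i p) +o lower F i)"

definition relations :: "('v, 'k) mpoly set" where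
  "relations = {p \<in> carrier P. peval scale a p = 0}"

lemmas subspace_lower' = subspace_lower[OF filtration]

lemma peval_mem_F:
  assumes "p \<in> carrier P" "\<And>\<mu>. \<mu> \<in> keys p \<Longrightarrow> mweight w \<mu> \<le> i"
  shows "peval scale a p \<in> F i"
  using assms by (auto simp: F_image)

lemma peval_hcomp_mem_F: "p \<in> carrier P \<Longrightarrow> peval scale a (hcomp w i p) \<in> F i"
  by (rule peval_mem_F) (simp_all add: hcomp_mem_mpoly_ring keys_hcomp)

lemma lower_image:
  "lower F i = peval scale a ` {p \<in> carrier P. \<forall>\<mu>\<in>keys p. mweight w \<mu> < i}"
proof (cases i)
  case 0
  have "{p \<in> carrier P. \<forall>\<mu>\<in>keys p. mweight w \<mu> < i} = {0}"
    using 0 by (auto simp: zero_mem_mpoly_ring)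
  then show ?thesis using 0 by (simp add: lower_def)
next
  case (Suc j)
  then show ?thesis by (simp add: lower_def F_image less_Suc_eq_le)
qed

lemma symbol_homogeneous:
  assumes "homogeneous w i p"
  shows "symbol p = gr_incl F i (peval scale a p)"
  by (rule ext) (simp add: symbol_def gr_incl_def hcomp_homogeneous[OF assms])

lemma symbol_add: "symbol (p + q) = (\<lambda>i. symbol p i + symbol q i)"
  by (rule ext) (simp add: symbol_def hcomp_add peval_add coset_add[OF subspace_lower'])

lemma symbol_mult:
  assumes "p \<in> carrier P" "q \<in> carrier P"
  shows "symbol (p * q) = symbol p \<otimes>\<^bsub>assoc_graded F\<^esub> symbol q"
proof (rule ext)
  fix i
  have "(symbol p \<otimes>\<^bsub>assoc_graded F\<^esub> symbol q) i =
      (\<Sum>j\<le>i. peval scale a (hcomp w j p) * peval scale a (hcomp w (i - j) q) +o lower F i)"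
  proof -
    have "symbol p j * symbol q (i - j) + lower F i =
        peval scale a (hcomp w j p) * peval scale a (hcomp w (i - j) q) +o lower F i"
      if "j \<in> {..i}" for j
      using coset_mult[OF filtration peval_hcomp_mem_F[OF assms(1), of j]
          peval_hcomp_mem_F[OF assms(2), of "i - j"]] that
      unfolding symbol_def by simp
    then show ?thesis
      unfolding assoc_graded_def by (auto intro!: sum.cong)
  qed
  also have "\<dots> = symbol (p * q) i"
    by (subst sum_coset[OF subspace_lower']) (simp_all add: symbol_def hcomp_mult peval_sum peval_mult)
  finally show "symbol (p * q) i = (symbol p \<otimes>\<^bsub>assoc_graded F\<^esub> symbol q) i" ..
qed

lemma symbol_mconst: "symbol (mconst c) = gr_incl F 0 (scale c 1)"
proof -
  have "homogeneous w 0 (mconst c)" by (simp add: homogeneous_def mconst_def)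
  from symbol_homogeneous[OF this] show ?thesis by (simp only: peval_mconst)
qed

lemma symbol_mem:
  assumes "p \<in> carrier P"
  shows "symbol p \<in> carrier (assoc_graded F)"
proof -
  have "i \<in> mweight w ` keys p" if "symbol p i \<noteq> lower F i" for i
  proof (rule ccontr)
    assume "i \<notin> mweight w ` keys p"
    then have "keys (hcomp w i p) = {}"
      by (auto simp: keys_hcomp)
    then have "hcomp w i p = 0" by simp
    then show False using that by (simp add: symbol_def)
  qed
  then have "{i. symbol p i \<noteq> lower F i} \<subseteq> mweight w ` keys p" by blast
  then have "finite {i. symbol p i \<noteq> lower F i}"
    by (rule finite_subset) simp
  moreover have "\<exists>b\<in>F i. symbol p i = b +o lower F i" for i
    using peval_hcomp_mem_F[OF assms] unfolding symbol_def by blast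
  ultimately show ?thesis by (simp add: assoc_graded_def)
qed

text \<open>
  Components of weight less than \<open>i\<close> have values in \<open>lower F i\<close>, so they can be discarded.
\<close>

lemma mem_F_homogeneous:
  assumes "b \<in> F i"
  obtains p where "p \<in> carrier P" "homogeneous w i p" "b - peval scale a p \<in> lower F i"
proof -
  obtain q where q: "q \<in> carrier P" "\<forall>\<mu>\<in>keys q. mweight w \<mu> \<le> i" and b: "b = peval scale a q"
    using assms by (auto simp: F_image)
  have "b - peval scale a (hcomp w i q) = peval scale a (q - hcomp w i q)"
    by (simp add: b peval_diff)
  also have "\<dots> \<in> lower F i"
  proof -
    have "mweight w \<mu> < i" if "\<mu> \<in> keys (q - hcomp w i q)" for \<mu>
    proof -
      have "\<mu> \<in> keys q" "mweight w \<mu> \<noteq> i"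
        using that by (auto simp: in_keys_iff lookup_minus lookup_hcomp split: if_splits)
      then show ?thesis using q(2) by (simp add: le_neq_implies_less)
    qed
    moreover have "q - hcomp w i q \<in> carrier P"
      using q(1) by (intro minus_mem_mpoly_ring hcomp_mem_mpoly_ring)
    ultimately show ?thesis
      unfolding lower_image by blast
  qed
  finally show ?thesis
    using that[of "hcomp w i q"] q(1) by (simp add: hcomp_mem_mpoly_ring homogeneous_hcomp)
qed

lemma gr_incl_eq_symbol:
  assumes "b \<in> F i"
  obtains p where "p \<in> carrier P" "homogeneous w i p" "gr_incl F i b = symbol p"
proof -
  obtain p where p: "p \<in> carrier P" "homogeneous w i p" "b - peval scale a p \<in> lower F i"
    using mem_F_homogeneous[OF assms] .
  then have "gr_incl F i b = symbol p"
    by (simp add: symbol_homogeneous gr_incl_def fun_eq_iff coset_eq_iff[OF subspace_lower'])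
  with p show ?thesis using that by blast
qed

lemma symbol_surj: "symbol ` carrier P = carrier (assoc_graded F)"
proof (intro subset_antisym subsetI)
  fix g assume g: "g \<in> carrier (assoc_graded F)"
  define S where "S = {i. g i \<noteq> lower F i}"
  have fin: "finite S" using g by (simp add: S_def assoc_graded_def)
  have "\<exists>p. p \<in> carrier P \<and> homogeneous w i p \<and> symbol p i = g i" for i
  proof -
    obtain b where "b \<in> F i" and gi: "g i = b +o lower F i"
      using g by (auto simp: assoc_graded_def)
    then obtain p where "p \<in> carrier P" "homogeneous w i p" "gr_incl F i b = symbol p"
      using gr_incl_eq_symbol by metis
    moreover have "gr_incl F i b i = g i" by (simp add: gr_incl_def gi)
    ultimately show ?thesis by metis
  qed
  then obtain p where p: "\<And>i. p i \<in> carrier P" "\<And>i. homogeneous w i (p i)" "\<And>i. symbol (p i) i = g i"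
    by metis
  have comp: "hcomp w i (\<Sum>j\<in>S. p j) = (if i \<in> S then p i else 0)" for i
  proof -
    have "hcomp w i (\<Sum>j\<in>S. p j) = (\<Sum>j\<in>S. hcomp w i (p j))"
      by (rule poly_mapping_eqI) (simp add: lookup_hcomp lookup_sum)
    also have "\<dots> = (if i \<in> S then p i else 0)"
      using fin by (simp add: hcomp_homogeneous[OF p(2)])
    finally show ?thesis .
  qed
  have "symbol (\<Sum>j\<in>S. p j) = g"
  proof (rule ext)
    fix i
    show "symbol (\<Sum>j\<in>S. p j) i = g i"
    proof (cases "i \<in> S")
      case True
      have "hcomp w i (p i) = p i" using hcomp_homogeneous[OF p(2)[of i], of i] by simp
      then show ?thesis using True p(3)[of i] unfolding symbol_def comp by simp
    next
      case False
      then show ?thesis unfolding symbol_def comp by (simp add: S_def)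
    qed
  qed
  moreover have "(\<Sum>j\<in>S. p j) \<in> carrier P"
    using fin p(1) by (induction S) (auto simp: zero_mem_mpoly_ring add_mem_mpoly_ring)
  ultimately show "g \<in> symbol ` carrier P" by blast
next
  fix g assume "g \<in> symbol ` carrier P"
  then show "g \<in> carrier (assoc_graded F)" using symbol_mem by blast
qed

text \<open>
  The ring axioms for the associated graded ring come for free: it is the image of a ring under a
  map that respects the operations.
\<close>

lemma symbol_ring_hom: "ring_hom_ring P (assoc_graded F) symbol"
proof -
  interpret cring P by (rule cring_mpoly_ring)
  have hom: "symbol \<in> ring_hom P (assoc_graded F)"
  proof (rule ring_hom_memI)
    fix p q assume "p \<in> carrier P" "q \<in> carrier P"
    then show "symbol (p \<otimes>\<^bsub>P\<^esub> q) = symbol p \<otimes>\<^bsub>assoc_graded F\<^esub> symbol q"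
      by (simp add: symbol_mult)
    show "symbol (p \<oplus>\<^bsub>P\<^esub> q) = symbol p \<oplus>\<^bsub>assoc_graded F\<^esub> symbol q"
      by (simp add: symbol_add) (simp add: assoc_graded_def)
  next
    have "symbol 1 = gr_incl F 0 1"
      using symbol_mconst[of 1] by (simp add: mconst_def)
    then show "symbol \<one>\<^bsub>P\<^esub> = \<one>\<^bsub>assoc_graded F\<^esub>"
      by (simp add: assoc_graded_def)
  qed (rule symbol_mem)
  have "symbol 0 = (\<lambda>i. lower F i)"
    unfolding symbol_def by (simp add: hcomp_def)
  then have "symbol 0 = \<zero>\<^bsub>assoc_graded F\<^esub>"
    by (simp add: assoc_graded_def)
  then have "ring (assoc_graded F)"
    using ring_hom_imp_img_ring[OF hom] by (simp add: symbol_surj)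
  then show ?thesis
    using hom by (intro ring_hom_ringI2 ring_axioms)
qed

text \<open>
  The value of a relation is zero, so the value of its top form is minus the value of the rest,
  which has smaller weight.
\<close>

lemma top_form_symbol:
  assumes "p \<in> relations"
  shows "peval scale a (hcomp w i (top_form w p)) \<in> lower F i"
proof -
  have p: "p \<in> carrier P" "peval scale a p = 0" using assms by (simp_all add: relations_def)
  define e where "e = Max (mweight w ` keys p)"
  have less: "mweight w \<mu> < e" if "\<mu> \<in> keys (p - hcomp w e p)" for \<mu>
  proof -
    have "\<mu> \<in> keys p" "mweight w \<mu> \<noteq> e"
      using that by (auto simp: in_keys_iff lookup_minus lookup_hcomp split: if_splits)
    moreover have "mweight w \<mu> \<le> e"
      unfolding e_def using \<open>\<mu> \<in> keys p\<close> by (intro Max_ge) auto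
    ultimately show ?thesis by simp
  qed
  have "p - hcomp w e p \<in> carrier P"
    using p(1) by (intro minus_mem_mpoly_ring hcomp_mem_mpoly_ring)
  then have "peval scale a (p - hcomp w e p) \<in> lower F e"
    unfolding lower_image using less by blast
  then have "- peval scale a (p - hcomp w e p) \<in> lower F e"
    by (rule subspace_neg[OF subspace_lower'])
  then have "peval scale a (hcomp w e p) \<in> lower F e"
    by (simp add: peval_diff p(2))
  then show ?thesis
    using subspace_0[OF subspace_lower', of i]
    by (cases "i = e") (simp_all add: top_form_def hcomp_homogeneous[OF homogeneous_hcomp] flip: e_def)
qed

text \<open>
  Conversely, if a nonzero component of weight \<open>i\<close> has the same value as some \<open>q\<close> of smaller
  weight, then it is the top form of a relation, namely of its difference with \<open>q\<close>.
\<close>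

lemma hcomp_eq_top_form:
  assumes p: "p \<in> carrier P" and low: "peval scale a (hcomp w i p) \<in> lower F i"
    and nz: "hcomp w i p \<noteq> 0"
  shows "hcomp w i p \<in> top_form w ` relations"
proof -
  obtain q where q: "q \<in> carrier P" "\<forall>\<mu>\<in>keys q. mweight w \<mu> < i"
    and eq: "peval scale a (hcomp w i p) = peval scale a q"
    using low unfolding lower_image by blast
  let ?r = "hcomp w i p - q"
  have "?r \<in> carrier P"
    using p q(1) by (intro minus_mem_mpoly_ring hcomp_mem_mpoly_ring)
  then have rel: "?r \<in> relations"
    using eq by (simp add: relations_def peval_diff)
  have q0: "lookup q \<mu> = 0" if "mweight w \<mu> \<ge> i" for \<mu>
    using q(2) that by (meson in_keys_iff linorder_not_less)
  have comp: "hcomp w i ?r = hcomp w i p"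
    using q0 by (intro poly_mapping_eqI) (simp add: lookup_hcomp lookup_minus)
  obtain \<mu> where \<mu>: "\<mu> \<in> keys (hcomp w i p)"
    using nz by (metis all_not_in_conv keys_eq_empty)
  then have \<mu>w: "mweight w \<mu> = i" by (simp add: keys_hcomp)
  then have "\<mu> \<in> keys ?r"
    using \<mu> q0[of \<mu>] by (simp add: in_keys_iff lookup_minus)
  have "Max (mweight w ` keys ?r) = i"
  proof (rule Max_eqI)
    show "i \<in> mweight w ` keys ?r"
      using \<open>\<mu> \<in> keys ?r\<close> \<mu>w by blast
    fix y assume "y \<in> mweight w ` keys ?r"
    then obtain \<nu> where \<nu>: "\<nu> \<in> keys ?r" "y = mweight w \<nu>" by blast
    show "y \<le> i"
    proof (rule ccontr)
      assume "\<not> y \<le> i"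
      then have "lookup q \<nu> = 0" "mweight w \<nu> \<noteq> i"
        using q0[of \<nu>] \<nu>(2) by simp_all
      then show False using \<nu>(1) by (simp add: in_keys_iff lookup_minus lookup_hcomp)
    qed
  qed simp
  then have "top_form w ?r = hcomp w i p"
    by (simp only: top_form_def comp)
  then show ?thesis
    using rel by (metis image_eqI)
qed

lemma kernel_symbol: "a_kernel P (assoc_graded F) symbol = genideal P (top_form w ` relations)"
proof -
  have mem_kernel: "p \<in> a_kernel P (assoc_graded F) symbol \<longleftrightarrow>
      p \<in> carrier P \<and> (\<forall>i. peval scale a (hcomp w i p) \<in> lower F i)" for p
  proof -
    have "\<zero>\<^bsub>assoc_graded F\<^esub> = lower F"
      by (simp add: assoc_graded_def)
    then have "symbol p = \<zero>\<^bsub>assoc_graded F\<^esub> \<longleftrightarrow> (\<forall>i. symbol p i = lower F i)"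
      by (simp only: fun_eq_iff)
    also have "\<dots> \<longleftrightarrow> (\<forall>i. peval scale a (hcomp w i p) \<in> lower F i)"
      unfolding symbol_def by (simp only: coset_eq_self_iff[OF subspace_lower'])
    finally show ?thesis unfolding a_kernel_def' by blast
  qed
  have top_carrier: "top_form w ` relations \<subseteq> carrier P"
    unfolding relations_def top_form_def using hcomp_mem_mpoly_ring by blast
  have ring: "ring P"
    using cring_mpoly_ring by (rule cring.axioms)
  have ideal: "ideal (genideal P (top_form w ` relations)) P"
    by (rule ring.genideal_ideal[OF ring top_carrier])
  show ?thesis
  proof (rule subset_antisym)
    show "genideal P (top_form w ` relations) \<subseteq> a_kernel P (assoc_graded F) symbol"
    proof (rule ring.genideal_minimal[OF ring ring_hom_ring.kernel_is_ideal[OF symbol_ring_hom]])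
      show "top_form w ` relations \<subseteq> a_kernel P (assoc_graded F) symbol"
        using top_form_symbol top_carrier mem_kernel by blast
    qed
  next
    show "a_kernel P (assoc_graded F) symbol \<subseteq> genideal P (top_form w ` relations)"
    proof
      fix p assume "p \<in> a_kernel P (assoc_graded F) symbol"
      then have p: "p \<in> carrier P" "\<And>i. peval scale a (hcomp w i p) \<in> lower F i"
        by (simp_all only: mem_kernel)
      have zero: "0 \<in> genideal P (top_form w ` relations)"
        using additive_subgroup.zero_closed[OF ideal.axioms(1)[OF ideal]] by simp
      have homog: "hcomp w i p \<in> genideal P (top_form w ` relations)" for i
        using hcomp_eq_top_form[OF p(1) p(2), of i] ring.genideal_self[OF ring top_carrier] zero
        by (cases "hcomp w i p = 0") auto
      have "(\<Sum>i\<in>A. hcomp w i p) \<in> genideal P (top_form w ` relations)" if "finite A" for A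
        using that
      proof induction
        case empty
        then show ?case using zero by simp
      next
        case (insert i A)
        then show ?case
          using additive_subgroup.a_closed[OF ideal.axioms(1)[OF ideal] homog] by simp
      qed
      from this[of "mweight w ` keys p"] show "p \<in> genideal P (top_form w ` relations)"
        by (simp add: sum_hcomp)
    qed
  qed
qed

text \<open>
  The isomorphism is the inverse of the one that \<open>symbol\<close> induces on the quotient; it sends the
  symbol of \<open>p\<close> to the class of \<open>p\<close>, from which its compatibility with scalars and degrees follows.
\<close>

theorem assoc_graded_iso:
  defines "K \<equiv> genideal P (top_form w ` relations)"
  shows "\<exists>\<phi>. graded_alg_iso
    (assoc_graded F) (\<lambda>c. gr_incl F 0 (scale c 1)) (\<lambda>i. gr_incl F i ` F i)
    (P Quot K) (\<lambda>c. K +>\<^bsub>P\<^esub> mconst c)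
    (\<lambda>i. {K +>\<^bsub>P\<^esub> p | p. p \<in> carrier P \<and> homogeneous w i p}) \<phi>"
proof -
  note hom = symbol_ring_hom
  have K: "K = a_kernel P (assoc_graded F) symbol"
    by (simp add: K_def kernel_symbol)
  define \<theta> where "\<theta> = (\<lambda>X. the_elem (symbol ` X))"
  have \<theta>: "\<theta> \<in> ring_iso (P Quot K) (assoc_graded F)"
    unfolding \<theta>_def K by (rule ring_hom_ring.FactRing_iso_set[OF hom symbol_surj])
  have quot: "ring (P Quot K)"
    unfolding K by (rule ideal.quotient_is_ring[OF ring_hom_ring.kernel_is_ideal[OF hom]])
  define \<phi> where "\<phi> = inv_into (carrier (P Quot K)) \<theta>"
  have \<phi>: "\<phi> \<in> ring_iso (assoc_graded F) (P Quot K)"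
    unfolding \<phi>_def by (rule ring_iso_set_sym[OF quot \<theta>])
  have \<phi>_symbol: "\<phi> (symbol p) = K +>\<^bsub>P\<^esub> p" if "p \<in> carrier P" for p
  proof -
    have "\<theta> (K +>\<^bsub>P\<^esub> p) = symbol p"
      unfolding \<theta>_def K by (rule ring_hom_ring.the_elem_simp[OF hom that])
    moreover have "K +>\<^bsub>P\<^esub> p \<in> carrier (P Quot K)"
      using that unfolding FactRing_def A_RCOSETS_def' by auto
    moreover have "inj_on \<theta> (carrier (P Quot K))"
      using ring_iso_memE(5)[OF \<theta>] by (simp add: bij_betw_def)
    ultimately show ?thesis
      unfolding \<phi>_def by (metis inv_into_f_f)
  qed
  have "\<phi> (gr_incl F 0 (scale c 1)) = K +>\<^bsub>P\<^esub> mconst c" for c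
    using \<phi>_symbol[OF mconst_mem_mpoly_ring] by (simp add: symbol_mconst)
  moreover have "\<phi> ` gr_incl F i ` F i = {K +>\<^bsub>P\<^esub> p | p. p \<in> carrier P \<and> homogeneous w i p}" for i
  proof (intro subset_antisym subsetI)
    fix y assume "y \<in> \<phi> ` gr_incl F i ` F i"
    then obtain b where "b \<in> F i" "y = \<phi> (gr_incl F i b)" by blast
    moreover obtain p where "p \<in> carrier P" "homogeneous w i p" "gr_incl F i b = symbol p"
      using gr_incl_eq_symbol[OF \<open>b \<in> F i\<close>] .
    ultimately show "y \<in> {K +>\<^bsub>P\<^esub> p | p. p \<in> carrier P \<and> homogeneous w i p}"
      using \<phi>_symbol by auto
  next
    fix y assume "y \<in> {K +>\<^bsub>P\<^esub> p | p. p \<in> carrier P \<and> homogeneous w i p}"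
    then obtain p where p: "p \<in> carrier P" "homogeneous w i p" "y = K +>\<^bsub>P\<^esub> p" by blast
    then have "peval scale a p \<in> F i"
      by (intro peval_mem_F) (auto simp: homogeneous_def)
    moreover have "y = \<phi> (gr_incl F i (peval scale a p))"
      using p(3) \<phi>_symbol[OF p(1)] symbol_homogeneous[OF p(2)] by simp
    ultimately show "y \<in> \<phi> ` gr_incl F i ` F i"
      by blast
  qed
  ultimately show ?thesis
    using \<phi> unfolding graded_alg_iso_def by blast
qed

end

section \<open>Locally nilpotent derivations\<close>

locale locally_nilpotent_derivation = k_algebra scale
  for scale :: "'k::field_char_0 \<Rightarrow> 'b::idom \<Rightarrow> 'b" +
  fixes D :: "'b \<Rightarrow> 'b"
  assumes derivation: "derivation scale D" and locally_nilpotent: "locally_nilpotent D"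
begin

abbreviation "F \<equiv> der_filtration D"

lemma D_add: "D (a + b) = D a + D b"
  and D_scale: "D (scale c a) = scale c (D a)"
  and D_mult: "D (a * b) = D a * b + a * D b"
  using derivation Vector_Spaces.linear.axioms(3)[of scale scale D] module_hom.add[of scale scale D]
    module_hom.scale[of scale scale D]
  unfolding derivation_def by (auto simp: linear_iff_module_hom)

lemma D_zero [simp]: "D 0 = 0"
  using D_scale[of 0 0] by simp

lemma D_one [simp]: "D 1 = 0"
  using D_mult[of 1 1] by (metis add_cancel_right_left mult_1 mult_1_right)

lemma D_diff: "D (a - b) = D a - D b"
  using D_add[of "a - b" b] by simp

lemma D_of_nat [simp]: "D (of_nat n) = 0"
  by (induction n) (simp_all add: D_add)

lemma of_nat_nonzero: "n \<noteq> 0 \<Longrightarrow> (of_nat n :: 'b) \<noteq> 0"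
proof -
  assume "n \<noteq> 0"
  have "of_nat k = scale (of_nat k) 1" for k
    by (induction k) (simp_all add: scale_left_distrib)
  then show ?thesis using \<open>n \<noteq> 0\<close> by (metis of_nat_eq_0_iff scale_eq_0_iff zero_neq_one)
qed

lemma F_0: "F 0 = der_ker D"
  by (simp add: der_filtration_def der_ker_def)

lemma mem_F_Suc: "a \<in> F (Suc i) \<longleftrightarrow> D a \<in> F i"
  by (simp add: der_filtration_def funpow_swap1)

lemma F_mono: "F i \<subseteq> F (Suc i)"
  by (auto simp: der_filtration_def)

lemma subspace_F: "subspace (F i)"
proof (induction i)
  case 0
  show ?case by (rule subspaceI) (simp_all add: F_0 der_ker_def D_add D_scale)
next
  case (Suc i)
  show ?case
    by (rule subspaceI)
      (simp_all add: mem_F_Suc D_add D_scale subspace_0[OF Suc] subspace_add[OF Suc] subspace_scale[OF Suc])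
qed

lemma ker_mult: "a \<in> der_ker D \<Longrightarrow> b \<in> F j \<Longrightarrow> a * b \<in> F j"
  by (induction j arbitrary: b) (auto simp: F_0 mem_F_Suc der_ker_def D_mult)

lemma F_mult: "a \<in> F i \<Longrightarrow> b \<in> F j \<Longrightarrow> a * b \<in> F (i + j)"
proof (induction "i + j" arbitrary: i j a b)
  case 0
  then show ?case by (simp add: ker_mult F_0[symmetric])
next
  case (Suc k)
  have left: "D a * b \<in> F k"
  proof (cases i)
    case 0
    then show ?thesis
      using Suc.prems by (simp add: F_0 der_ker_def subspace_0[OF subspace_F])
  next
    case (Suc i')
    then show ?thesis
      using Suc.hyps(1)[of i' j] Suc.hyps(2) Suc.prems by (simp add: mem_F_Suc)
  qed
  have right: "a * D b \<in> F k"
  proof (cases j)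
    case 0
    then show ?thesis
      using Suc.prems by (simp add: F_0 der_ker_def subspace_0[OF subspace_F])
  next
    case (Suc j')
    then show ?thesis
      using Suc.hyps(1)[of i j'] Suc.hyps(2) Suc.prems by (simp add: mem_F_Suc)
  qed
  show ?case
    unfolding Suc.hyps(2)[symmetric] mem_F_Suc D_mult
    by (rule subspace_add[OF subspace_F left right])
qed

lemma mem_F_if_nilpotent: "(D ^^ n) a = 0 \<Longrightarrow> a \<in> F n"
  by (simp add: der_filtration_def)

lemma nfiltration_F: "nfiltration scale F"
proof -
  have "a \<in> (\<Union>i. F i)" for a
  proof -
    obtain n where "(D ^^ n) a = 0"
      using locally_nilpotent unfolding locally_nilpotent_def by blast
    then show ?thesis using mem_F_if_nilpotent by blast
  qed
  then show ?thesis
    using subspace_F F_mono F_mult unfolding nfiltration_def by blast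
qed

lemma one_mem_F: "1 \<in> F 0"
  by (simp add: F_0 der_ker_def)

lemma der_deg_mem_F:
  assumes "der_deg D a = ereal (real k)"
  shows "a \<in> F k"
proof -
  have k: "k = (LEAST i. (D ^^ (i + 1)) a = 0)"
    using assms unfolding der_deg_def by (simp split: if_splits)
  obtain n where "(D ^^ n) a = 0"
    using locally_nilpotent unfolding locally_nilpotent_def by blast
  then have "(D ^^ (n + 1)) a = 0" by simp
  then have "(D ^^ (k + 1)) a = 0"
    unfolding k by (rule LeastI)
  then show ?thesis by (simp add: der_filtration_def)
qed

lemma der_deg_D_nonzero:
  assumes "der_deg D a = ereal (real k)" "k \<noteq> 0"
  shows "D a \<noteq> 0"
proof
  assume "D a = 0"
  then have "(LEAST i. (D ^^ (i + 1)) a = 0) = 0"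
    by (intro Least_eq_0) simp
  then show False
    using assms unfolding der_deg_def by (simp split: if_splits)
qed

lemma funpow_D_ker_mult: "c \<in> der_ker D \<Longrightarrow> (D ^^ n) (c * b) = c * (D ^^ n) b"
  by (induction n) (simp_all add: D_mult der_ker_def)

lemma funpow_D_diff: "(D ^^ n) (a - b) = (D ^^ n) a - (D ^^ n) b"
  by (induction n) (simp_all add: D_diff)

text \<open>
  In the Leibniz formula for \<open>(D ^^ Suc n) (s * b)\<close> only two terms survive, since \<open>D (D s) = 0\<close>.
\<close>

lemma funpow_D_slice_mult:
  assumes "D (D s) = 0"
  shows "(D ^^ Suc n) (s * b) = s * (D ^^ Suc n) b + of_nat (Suc n) * D s * (D ^^ n) b"
proof (induction n)
  case (Suc n)
  have "(D ^^ Suc (Suc n)) (s * b) = D (s * (D ^^ Suc n) b + of_nat (Suc n) * D s * (D ^^ n) b)"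
    using Suc by simp
  also have "\<dots> = s * (D ^^ Suc (Suc n)) b + of_nat (Suc (Suc n)) * D s * (D ^^ Suc n) b"
    by (simp only: D_add D_mult D_of_nat assms funpow.simps o_apply) (simp add: algebra_simps)
  finally show ?case .
qed (simp add: D_mult)

text \<open>
  A power \<open>s ^ n\<close> of a local slice has degree exactly \<open>n\<close>: its \<open>n\<close>-th derivative is
  \<open>fact n * D s ^ n\<close>, which is nonzero in characteristic zero.
\<close>

lemma funpow_D_slice_power:
  assumes "D s \<noteq> 0" "D (D s) = 0"
  shows "(D ^^ n) (s ^ n) \<noteq> 0" and "s ^ n \<in> F n"
proof -
  have "s \<in> F 1" using assms(2) by (simp add: der_filtration_def)
  from nfiltration_power[OF nfiltration_F one_mem_F this, of n for n]
  have mem: "s ^ n \<in> F n" for n by simp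
  then show "s ^ n \<in> F n" .
  show "(D ^^ n) (s ^ n) \<noteq> 0"
  proof (induction n)
    case (Suc n)
    have "(D ^^ Suc n) (s ^ n) = 0"
      using mem[of n] by (simp add: der_filtration_def)
    then have "(D ^^ Suc n) (s ^ Suc n) = of_nat (Suc n) * D s * (D ^^ n) (s ^ n)"
      using funpow_D_slice_mult[OF assms(2), of n "s ^ n"] by simp
    then show ?case
      using Suc assms(1) of_nat_nonzero[of "Suc n"] by simp
  qed simp
qed

text \<open>
  This is the expansion of \<open>b\<close> in powers of a local slice \<open>s\<close>, with denominators cleared.  With
  \<open>e\<close> and \<open>g\<close> the \<open>n\<close>-th derivatives of \<open>s ^ n\<close> and \<open>b\<close>, both in the kernel of \<open>D\<close>, the \<open>n\<close>-th
  derivative of \<open>e * b - g * s ^ n\<close> is \<open>e * g - g * e = 0\<close>, so the degree has dropped below \<open>n\<close>.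
\<close>

lemma kernel_multiple_mem_filtration:
  assumes G: "nfiltration scale G" and ker: "der_ker D \<subseteq> G 0"
    and s: "s \<in> G 1" "D s \<noteq> 0" "D (D s) = 0"
    and b: "b \<in> F i"
  shows "\<exists>e\<in>der_ker D. e \<noteq> 0 \<and> e * b \<in> G i"
  using b
proof (induction i arbitrary: b)
  case 0
  then show ?case using ker by (intro bexI[of _ 1]) (auto simp: F_0 der_ker_def)
next
  case (Suc i)
  let ?n = "Suc i"
  define e where "e = (D ^^ ?n) (s ^ ?n)"
  define g where "g = (D ^^ ?n) b"
  have e: "e \<in> der_ker D" "e \<noteq> 0"
    using funpow_D_slice_power[OF s(2,3), of ?n] by (simp_all add: e_def der_ker_def der_filtration_def)
  have g: "g \<in> der_ker D"
    using Suc.prems by (simp add: g_def der_ker_def der_filtration_def)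
  have "(D ^^ ?n) (e * b - g * s ^ ?n) = 0"
    unfolding funpow_D_diff funpow_D_ker_mult[OF e(1)] funpow_D_ker_mult[OF g]
    by (simp only: e_def[symmetric] g_def[symmetric]) (simp add: mult.commute)
  then have "e * b - g * s ^ ?n \<in> F i"
    by (simp add: der_filtration_def)
  from Suc.IH[OF this] obtain e' where e': "e' \<in> der_ker D" "e' \<noteq> 0" "e' * (e * b - g * s ^ ?n) \<in> G i"
    by blast
  have sub: "subspace (G ?n)" using G by (simp add: nfiltration_def)
  have "1 \<in> G 0" using ker by (auto simp: der_ker_def)
  from nfiltration_power[OF G this s(1), of ?n] have "s ^ ?n \<in> G ?n" by simp
  moreover have "e' * g \<in> G 0"
    using e'(1) g ker by (auto simp: der_ker_def D_mult)
  ultimately have "(e' * g) * s ^ ?n \<in> G (0 + ?n)"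
    using G unfolding nfiltration_def by blast
  moreover have "e' * (e * b - g * s ^ ?n) \<in> G ?n"
    using e'(3) nfiltration_mono[OF G, of i ?n] by auto
  ultimately have "e' * (e * b - g * s ^ ?n) + (e' * g) * s ^ ?n \<in> G ?n"
    using subspace_add[OF sub] by simp
  then have "(e' * e) * b \<in> G ?n"
    by (simp add: algebra_simps)
  moreover have "e' * e \<in> der_ker D" "e' * e \<noteq> 0"
    using e e' by (simp_all add: der_ker_def D_mult)
  ultimately show ?case by blast
qed

text \<open>
  The multiplier \<open>e\<close> of the preceding lemma has degree \<open>0\<close> for \<open>G\<close>.  As degrees add for a proper
  filtration, \<open>b\<close> has the same \<open>G\<close>-degree as \<open>e * b\<close>.
\<close>

lemma F_subset_proper_filtration:
  assumes G: "proper_nfiltration scale G" and ker: "der_ker D \<subseteq> G 0"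
    and s: "s \<in> G 1" "D s \<noteq> 0" "D (D s) = 0"
  shows "F i \<subseteq> G i"
proof
  fix b assume b: "b \<in> F i"
  have nG: "nfiltration scale G" using G by (simp add: proper_nfiltration_def)
  show "b \<in> G i"
  proof (cases "b = 0")
    case True
    then show ?thesis using nG subspace_0 by (simp add: nfiltration_def)
  next
    case False
    obtain e where e: "e \<in> der_ker D" "e \<noteq> 0" "e * b \<in> G i"
      using kernel_multiple_mem_filtration[OF nG ker s b] by blast
    \<comment> \<open>the degree of \<open>b\<close> with respect to \<open>G\<close>\<close>
    define j where "j = (LEAST j. b \<in> G j)"
    have "b \<in> (\<Union>j. G j)" using nG unfolding nfiltration_def by simp
    then obtain k where "b \<in> G k" by blast
    then have bj: "b \<in> G j" unfolding j_def by (rule LeastI)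
    have "b \<notin> lower G j"
    proof (cases j)
      case 0
      then show ?thesis using False by (simp add: lower_def)
    next
      case (Suc k)
      then have "k < j" by simp
      then have "b \<notin> G k" unfolding j_def by (rule not_less_Least)
      then show ?thesis using Suc by (simp add: lower_def)
    qed
    moreover have "e \<in> G 0 - lower G 0"
      using e ker by (auto simp: lower_def)
    ultimately have "e * b \<in> G (0 + j) - lower G (0 + j)"
      using G bj unfolding proper_nfiltration_def by blast
    then have notin: "e * b \<notin> lower G j" by simp
    have "j \<le> i"
    proof (rule ccontr)
      assume "\<not> j \<le> i"
      then obtain k where "j = Suc k" "i \<le> k"
        by (metis less_Suc_eq_le not_le_imp_less old.nat.exhaust not_less_zero)
      then have "e * b \<in> lower G j"
        using e(3) nfiltration_mono[OF nG, of i k] by (auto simp: lower_def)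
      then show False using notin by simp
    qed
    then show ?thesis using bj nfiltration_mono[OF nG] by blast
  qed
qed

text \<open>
  The degenerate case without a local slice: then the filtration never grows.
\<close>

lemma F_subset_kernel:
  assumes "F 1 \<subseteq> der_ker D"
  shows "F i \<subseteq> der_ker D"
proof (induction i)
  case (Suc i)
  show ?case
  proof
    fix a assume "a \<in> F (Suc i)"
    then have "D a \<in> der_ker D" using Suc by (auto simp: mem_F_Suc)
    then have "a \<in> F 1" using mem_F_Suc[of a 0] by (simp add: F_0)
    then show "a \<in> der_ker D" using assms by blast
  qed
qed (simp add: F_0)

end

section \<open>The filtration generated by the slices and the generators\<close>

lemma mem_sum_sets:
  fixes S :: "'i \<Rightarrow> 'a::comm_monoid_add set"
  assumes "finite A" "j \<in> A" "\<And>i. i \<in> A \<Longrightarrow> 0 \<in> S i"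
  shows "S j \<subseteq> sum S A"
proof
  fix x assume "x \<in> S j"
  then have "\<forall>i\<in>A. (if i = j then x else 0) \<in> S i" using assms(3) by auto
  moreover have "x = (\<Sum>i\<in>A. if i = j then x else 0)" using assms(1,2) by simp
  ultimately show "x \<in> sum S A"
    unfolding set_sum_alt[OF assms(1)] by (intro CollectI exI[of _ "\<lambda>i. if i = j then x else 0"]) blast
qed

context k_algebra
begin

lemma H_part_subset_G_filtration:
  assumes "j \<le> i"
  shows "H_part scale D m s n x d j \<subseteq> G_filtration scale D m s n x d i"
  unfolding G_filtration_def using assms
  by (intro mem_sum_sets) (simp_all add: H_part_def span_zero)

lemma ker_subset_G_filtration: "der_ker D \<subseteq> G_filtration scale D m s n x d 0"
proof
  fix a assume "a \<in> der_ker D"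
  then have "a * ((\<Prod>l=1..m. s l ^ 0) * (\<Prod>i=1..n. x i ^ 0)) \<in> H_part scale D m s n x d 0"
    unfolding H_part_def
    by (intro span_base CollectI exI[of _ a] exI[of _ "\<lambda>_. 0"]) simp
  then show "a \<in> G_filtration scale D m s n x d 0"
    by (intro subsetD[OF H_part_subset_G_filtration[of 0]]) simp_all
qed

lemma slice_mem_G_filtration:
  assumes "l \<in> {1..m}" "D 1 = 0"
  shows "s l \<in> G_filtration scale D m s n x d 1"
proof -
  define u where "u = (\<lambda>l'. if l' = l then 1 else 0 :: nat)"
  have "(\<Prod>l'=1..m. s l' ^ u l') = (\<Prod>l'=1..m. if l' = l then s l' else 1)"
    by (intro prod.cong) (simp_all add: u_def)
  also have "\<dots> = s l" using assms(1) by simp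
  finally have s: "(\<Prod>l'=1..m. s l' ^ u l') = s l" .
  have "1 * ((\<Prod>l'=1..m. s l' ^ u l') * (\<Prod>i=1..n. x i ^ 0)) \<in> H_part scale D m s n x d 1"
    unfolding H_part_def using assms
    by (intro span_base CollectI exI[of _ 1] exI[of _ u] exI[of _ "\<lambda>_. 0"])
      (simp add: der_ker_def, simp add: u_def)
  then have "s l \<in> H_part scale D m s n x d 1"
    unfolding s by simp
  then show ?thesis
    by (intro subsetD[OF H_part_subset_G_filtration[of 1]]) simp_all
qed

lemma weighted_image_prod_power:
  assumes "finite A" "\<And>v. v \<in> A \<Longrightarrow> f v \<in> weighted_image scale V w a (g v)"
  shows "(\<Prod>v\<in>A. f v ^ k v) \<in> weighted_image scale V w a (\<Sum>v\<in>A. g v * k v)"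
proof -
  have pow: "b ^ e \<in> weighted_image scale V w a (i * e)" if "b \<in> weighted_image scale V w a i" for b i e
  proof (induction e)
    case (Suc e)
    show ?case using weighted_image_mult[OF that Suc] by simp
  qed (simp add: weighted_image_one)
  show ?thesis
    using assms
  proof (induction A)
    case (insert v A)
    then have "f v ^ k v * (\<Prod>v\<in>A. f v ^ k v) \<in> weighted_image scale V w a (g v * k v + (\<Sum>v\<in>A. g v * k v))"
      by (intro weighted_image_mult pow) auto
    then show ?case using insert by simp
  qed (simp add: weighted_image_one)
qed

text \<open>
  The generators of \<open>H_part\<close> in degree \<open>j\<close> are values of monomials of weight \<open>j\<close> with coefficients in
  the kernel of \<open>D\<close>; these coefficients are polynomials in the \<open>z j\<close>, and the variables
  \<open>Z\<close> have weight \<open>0\<close>.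
\<close>

lemma G_filtration_subset_weighted_image:
  assumes ker: "der_ker D = alg_gen scale (z ` {1..r})"
  shows "G_filtration scale D m s n x d i \<subseteq>
    weighted_image scale (zxsvars r n m) (omega_weight d) (case_var z x s) i"
proof -
  let ?W = "weighted_image scale (zxsvars r n m) (omega_weight d) (case_var z x s)"
  have z: "z j \<in> ?W 0" if "j \<in> {1..r}" for j
    using weighted_image_var[of "ZVar j" "zxsvars r n m" "case_var z x s" "omega_weight d"] that
    by (simp add: zxsvars_def omega_weight_def)
  have x: "x j \<in> ?W (d j)" if "j \<in> {1..n}" for j
    using weighted_image_var[of "XVar j" "zxsvars r n m" "case_var z x s" "omega_weight d"] that
    by (simp add: zxsvars_def omega_weight_def)
  have s: "s j \<in> ?W 1" if "j \<in> {1..m}" for j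
    using weighted_image_var[of "SVar j" "zxsvars r n m" "case_var z x s" "omega_weight d"] that
    by (simp add: zxsvars_def omega_weight_def)
  have "subalgebra scale (?W 0)"
    using weighted_image_mult[of _ "zxsvars r n m" "omega_weight d" "case_var z x s" 0 _ 0]
    by (auto simp: subalgebra_def subspace_weighted_image weighted_image_one)
  then have W0: "der_ker D \<subseteq> ?W 0"
    unfolding ker alg_gen_def using z by (intro Inter_lower) auto
  have H: "H_part scale D m s n x d j \<subseteq> ?W j" for j
    unfolding H_part_def
  proof (rule span_minimal[OF _ subspace_weighted_image], rule subsetI)
    fix b assume "b \<in> {a * ((\<Prod>l=1..m. s l ^ u l) * (\<Prod>i=1..n. x i ^ v i)) | a u v.
          a \<in> der_ker D \<and> (\<Sum>l=1..m. u l) + (\<Sum>i=1..n. d i * v i) = j}"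
    then obtain a u v where b: "b = a * ((\<Prod>l=1..m. s l ^ u l) * (\<Prod>i=1..n. x i ^ v i))"
      and a: "a \<in> der_ker D" and j: "(\<Sum>l=1..m. u l) + (\<Sum>i=1..n. d i * v i) = j"
      by blast
    have "b \<in> ?W (0 + ((\<Sum>l=1..m. 1 * u l) + (\<Sum>i=1..n. d i * v i)))"
      unfolding b using a W0 s x
      by (intro weighted_image_mult weighted_image_prod_power) auto
    then show "b \<in> ?W j" by (simp only: add_0 mult_1 j)
  qed
  show ?thesis
  proof
    fix b assume "b \<in> G_filtration scale D m s n x d i"
    then obtain f where b: "b = (\<Sum>j\<le>i. f j)" and f: "\<forall>j\<in>{..i}. f j \<in> H_part scale D m s n x d j"
      unfolding G_filtration_def by (auto simp: set_sum_alt)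
    show "b \<in> ?W i"
      unfolding b
    proof (rule subspace_sum[OF subspace_weighted_image])
      fix j assume "j \<in> {..i}"
      then show "f j \<in> ?W i"
        using f H[of j] weighted_image_mono[of j i] by blast
    qed
  qed
qed

end

section \<open>The ideal of relations\<close>

context k_algebra
begin

lemma ideal_peval_kernel:
  fixes V :: "'v set"
  shows "ideal {p \<in> carrier (mpoly_ring V). peval scale a p = 0} (mpoly_ring V)"
proof (rule idealI)
  show "ring (mpoly_ring V :: ('v, 'k) mpoly ring)"
    using cring_mpoly_ring by (rule cring.axioms)
  show "subgroup {p \<in> carrier (mpoly_ring V). peval scale a p = 0} (add_monoid (mpoly_ring V))"
  proof
    fix p assume p: "p \<in> {p \<in> carrier (mpoly_ring V). peval scale a p = 0}"
    then have "inv\<^bsub>add_monoid (mpoly_ring V)\<^esub> p = - p"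
      using a_inv_mpoly_ring[of p V] by (simp add: a_inv_def)
    then show "inv\<^bsub>add_monoid (mpoly_ring V)\<^esub> p \<in> {p \<in> carrier (mpoly_ring V). peval scale a p = 0}"
      using p by (simp add: peval_uminus uminus_mem_mpoly_ring)
  qed (auto simp: peval_add add_mem_mpoly_ring zero_mem_mpoly_ring)
qed (auto simp: peval_mult mult_mem_mpoly_ring)

lemma xeval_eq_peval:
  assumes "p \<in> carrier (mpoly_ring (xvars n))"
  shows "xeval scale x p = peval scale (case_var z x s) p"
  unfolding xeval_def using assms by (rule peval_cong) (auto simp: xvars_def)

lemma mpoly_ring_mono: "U \<subseteq> V \<Longrightarrow> carrier (mpoly_ring U) \<subseteq> carrier (mpoly_ring V)"
  unfolding mem_carrier_mpoly_ring by (intro subsetI) (simp add: mem_carrier_mpoly_ring, blast)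

lemma xvars_subset: "xvars n \<subseteq> zxsvars r n m"
  by (auto simp: xvars_def zxsvars_def)

text \<open>
  Modulo the generators \<open>mvar (ZVar j) - zp j\<close> and \<open>mvar (SVar l) - sp l\<close> every polynomial is
  congruent to one in the variables \<open>X\<close> alone (\<open>reduce\<close> in the proof), and a relation among the
  \<open>x i\<close> alone belongs to \<open>I\<close>.
\<close>

lemma J_ideal_eq_kernel:
  assumes pres: "presented_by scale n x I"
    and zp: "\<And>j. j \<in> {1..r} \<Longrightarrow> zp j \<in> carrier (mpoly_ring (xvars n)) \<and> xeval scale x (zp j) = z j"
    and sp: "\<And>l. l \<in> {1..m} \<Longrightarrow> sp l \<in> carrier (mpoly_ring (xvars n)) \<and> xeval scale x (sp l) = s l"
  shows "J_ideal r n m I zp sp =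
    {p \<in> carrier (mpoly_ring (zxsvars r n m)). peval scale (case_var z x s) p = 0}"
proof -
  let ?V = "zxsvars r n m" and ?X = "carrier (mpoly_ring (xvars n)) :: (var, 'k) mpoly set"
    and ?ev = "peval scale (case_var z x s)"
  let ?P = "mpoly_ring ?V :: (var, 'k) mpoly ring"
  let ?gens = "I \<union> (\<lambda>j. mvar (ZVar j) - zp j) ` {1..r} \<union> (\<lambda>l. mvar (SVar l) - sp l) ` {1..m}"
  let ?J = "J_ideal r n m I zp sp"
  have ring: "ring ?P"
    using cring_mpoly_ring by (rule cring.axioms)
  have X: "?X \<subseteq> carrier ?P" by (rule mpoly_ring_mono[OF xvars_subset])
  have I: "I = {p \<in> ?X. ?ev p = 0}"
    using pres xeval_eq_peval[of _ n x z s] unfolding presented_by_def by auto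
  have zv: "mvar (ZVar j) \<in> carrier ?P" if "j \<in> {1..r}" for j
    using that by (intro mvar_mem_mpoly_ring) (auto simp: zxsvars_def)
  have sv: "mvar (SVar l) \<in> carrier ?P" if "l \<in> {1..m}" for l
    using that by (intro mvar_mem_mpoly_ring) (auto simp: zxsvars_def)
  have gens: "?gens \<subseteq> {p \<in> carrier ?P. ?ev p = 0}"
  proof (intro Un_least image_subsetI)
    show "I \<subseteq> {p \<in> carrier ?P. ?ev p = 0}" using I X by blast
    fix j assume j: "j \<in> {1..r}"
    have "?ev (zp j) = z j" using zp[OF j] xeval_eq_peval[of "zp j" n x z s] by simp
    then show "mvar (ZVar j) - zp j \<in> {p \<in> carrier ?P. ?ev p = 0}"
      using zp[OF j] zv[OF j] X by (auto simp: peval_diff peval_mvar intro!: minus_mem_mpoly_ring)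
  next
    fix l assume l: "l \<in> {1..m}"
    have "?ev (sp l) = s l" using sp[OF l] xeval_eq_peval[of "sp l" n x z s] by simp
    then show "mvar (SVar l) - sp l \<in> {p \<in> carrier ?P. ?ev p = 0}"
      using sp[OF l] sv[OF l] X by (auto simp: peval_diff peval_mvar intro!: minus_mem_mpoly_ring)
  qed
  then have gens_carrier: "?gens \<subseteq> carrier ?P" by blast
  have sub: "?J \<subseteq> {p \<in> carrier ?P. ?ev p = 0}"
    unfolding J_ideal_def by (rule ring.genideal_minimal[OF ring ideal_peval_kernel gens])
  have J: "ideal ?J ?P"
    unfolding J_ideal_def by (rule ring.genideal_ideal[OF ring gens_carrier])
  have gens_J: "?gens \<subseteq> ?J"
    unfolding J_ideal_def by (rule ring.genideal_self[OF ring gens_carrier])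
  have J_add: "p + q \<in> ?J" if "p \<in> ?J" "q \<in> ?J" for p q
    using additive_subgroup.a_closed[OF ideal.axioms(1)[OF J] that] by simp
  have J_mult: "p * q \<in> ?J" if "p \<in> carrier ?P" "q \<in> ?J" for p q
    using ideal.I_l_closed[OF J that(2,1)] by simp
  have J_zero: "0 \<in> ?J"
    using additive_subgroup.zero_closed[OF ideal.axioms(1)[OF J]] by simp
  have reduce: "\<exists>q\<in>?X. p - q \<in> ?J" if "p \<in> carrier ?P" for p
    using that
  proof (induction rule: mpoly_ring_induct)
    case (const c)
    show ?case using J_zero by (intro bexI[of _ "mconst c"]) (auto simp: mconst_mem_mpoly_ring)
  next
    case (var v)
    then consider j where "j \<in> {1..r}" "v = ZVar j" | j where "j \<in> {1..n}" "v = XVar j"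
      | l where "l \<in> {1..m}" "v = SVar l"
      by (auto simp: zxsvars_def)
    then show ?case
    proof cases
      case 1
      then show ?thesis using zp[of j] gens_J by (intro bexI[of _ "zp j"]) auto
    next
      case 2
      then show ?thesis
        using J_zero by (intro bexI[of _ "mvar v"]) (auto simp: xvars_def intro!: mvar_mem_mpoly_ring)
    next
      case 3
      then show ?thesis using sp[of l] gens_J by (intro bexI[of _ "sp l"]) auto
    qed
  next
    case (add p q)
    then obtain p' q' where p': "p' \<in> ?X" "p - p' \<in> ?J" and q': "q' \<in> ?X" "q - q' \<in> ?J" by blast
    have "(p - p') + (q - q') \<in> ?J" by (rule J_add[OF p'(2) q'(2)])
    then show ?case
      using add_mem_mpoly_ring[OF p'(1) q'(1)] by (intro bexI[of _ "p' + q'"]) (simp_all add: algebra_simps)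
  next
    case (mult p q)
    then obtain p' q' where p': "p' \<in> ?X" "p - p' \<in> ?J" and q': "q' \<in> ?X" "q - q' \<in> ?J" by blast
    \<comment> \<open>this sum is \<open>p * q - p' * q'\<close>\<close>
    have "p * (q - q') + q' * (p - p') \<in> ?J"
      using mult.hyps X p' q' by (intro J_add J_mult) auto
    then show ?case
      using mult_mem_mpoly_ring[OF p'(1) q'(1)] by (intro bexI[of _ "p' * q'"]) (simp_all add: algebra_simps)
  qed
  have "p \<in> ?J" if p: "p \<in> carrier ?P" "?ev p = 0" for p
  proof -
    obtain q where q: "q \<in> ?X" "p - q \<in> ?J" using reduce[OF p(1)] by blast
    have "?ev (p - q) = 0" using q(2) sub by blast
    then have "q \<in> I" using p(2) q(1) by (simp add: I peval_diff)
    then have "q \<in> ?J" using gens_J by blast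
    from J_add[OF q(2) this] show ?thesis by simp
  qed
  then show ?thesis using sub by blast
qed

end

section \<open>The associated graded algebra of the derivation\<close>

theorem proposition2p6:
  fixes scale :: "'k::field_char_0 \<Rightarrow> 'b::idom \<Rightarrow> 'b"
    and n r m :: nat
    and x z s :: "nat \<Rightarrow> 'b"
    and D :: "'b \<Rightarrow> 'b"
    and d :: "nat \<Rightarrow> nat"
    and I :: "(var, 'k) mpoly set"
    and zp sp :: "nat \<Rightarrow> (var, 'k) mpoly"
  assumes algebra: "k_algebra scale"
    and presentation: "presented_by scale n x I"
    and origin: "I \<subseteq> genideal (mpoly_ring (xvars n)) ((\<lambda>i. mvar (XVar i)) ` {1..n})"
    and derivation: "derivation scale D"
    and nilpotent: "locally_nilpotent D"
    and degree: "\<And>i. i \<in> {1..n} \<Longrightarrow> der_deg D (x i) = ereal (real (d i))"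
    and kernel_generators: "der_ker D = alg_gen scale (z ` {1..r})"
    and z_rep: "\<And>j. j \<in> {1..r} \<Longrightarrow>
      zp j \<in> carrier (mpoly_ring (xvars n)) \<and> xeval scale x (zp j) = z j"
    and z_origin: "\<And>j. j \<in> {1..r} \<Longrightarrow> xeval (*) (\<lambda>_. 0) (zp j) = 0"
    and s_filtration: "\<And>l. l \<in> {1..m} \<Longrightarrow> s l \<in> der_filtration D 1"
    and s_irreducible: "\<And>l. l \<in> {1..m} \<Longrightarrow> irreducible (s l)"
    and s_degree: "\<And>l. l \<in> {1..m} \<Longrightarrow> der_deg D (s l) = 1"
    and s_rep: "\<And>l. l \<in> {1..m} \<Longrightarrow>
      sp l \<in> carrier (mpoly_ring (xvars n)) \<and> xeval scale x (sp l) = s l"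
    and s_origin: "\<And>l. l \<in> {1..m} \<Longrightarrow> xeval (*) (\<lambda>_. 0) (sp l) = 0"
    and F1_generators: "der_filtration D 1 =
      {(\<Sum>l=1..m. a l * s l) + b | a b. (\<forall>l. a l \<in> der_ker D) \<and> b \<in> der_ker D}"
    and plinth_generators: "der_ker D \<inter> range D =
      {\<Sum>l=1..m. a l * D (s l) | a. \<forall>l. a l \<in> der_ker D}"
    and proper: "proper_nfiltration scale (G_filtration scale D m s n x d)"
  shows "\<exists>\<phi>. graded_alg_iso
    (assoc_graded (der_filtration D))
    (\<lambda>c. gr_incl (der_filtration D) 0 (scale c 1))
    (\<lambda>i. gr_incl (der_filtration D) i ` der_filtration D i)
    (mpoly_ring (zxsvars r n m) Quot J_hat r n m d I zp sp)
    (\<lambda>c. J_hat r n m d I zp sp +>\<^bsub>mpoly_ring (zxsvars r n m)\<^esub> mconst c)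
    (\<lambda>i. {J_hat r n m d I zp sp +>\<^bsub>mpoly_ring (zxsvars r n m)\<^esub> p | p.
            p \<in> carrier (mpoly_ring (zxsvars r n m)) \<and> homogeneous (omega_weight d) i p})
    \<phi>"
proof -
  interpret alg: k_algebra scale by (rule algebra)
  interpret lnd: locally_nilpotent_derivation scale D
    using derivation nilpotent by unfold_locales
  let ?F = "der_filtration D" and ?G = "G_filtration scale D m s n x d"
  let ?V = "zxsvars r n m" and ?w = "omega_weight d" and ?a = "case_var z x s"
  have nG: "nfiltration scale ?G" using proper by (simp add: proper_nfiltration_def)
  have F_G: "?F i \<subseteq> ?G i" for i
  proof (cases "m = 0")
    case True
    then have "?F 1 \<subseteq> der_ker D"
      unfolding F1_generators by auto
    then have "?F i \<subseteq> der_ker D" by (rule lnd.F_subset_kernel)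
    also have "\<dots> \<subseteq> ?G 0" by (rule alg.ker_subset_G_filtration)
    also have "\<dots> \<subseteq> ?G i" by (rule alg.nfiltration_mono[OF nG]) simp
    finally show ?thesis .
  next
    case False
    then have one: "1 \<in> {1..m}" by simp
    have "D (D (s 1)) = 0"
      using s_filtration[OF one] by (simp add: der_filtration_def)
    moreover have "D (s 1) \<noteq> 0"
      using s_degree[OF one] by (intro lnd.der_deg_D_nonzero[of _ 1]) (simp_all add: one_ereal_def)
    moreover have "s 1 \<in> ?G 1"
      using one lnd.D_one by (rule alg.slice_mem_G_filtration)
    ultimately show ?thesis
      by (intro lnd.F_subset_proper_filtration[OF proper alg.ker_subset_G_filtration])
  qed
  have G_W: "?G i \<subseteq> weighted_image scale ?V ?w ?a i" for i
    by (rule alg.G_filtration_subset_weighted_image[OF kernel_generators])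
  have z_ker: "z j \<in> ?F 0" if "j \<in> {1..r}" for j
    using that unfolding lnd.F_0 kernel_generators alg_gen_def by blast
  have "?a v \<in> ?F (?w v)" if "v \<in> ?V" for v
    using that z_ker s_filtration lnd.der_deg_mem_F[OF degree]
    by (auto simp: zxsvars_def omega_weight_def)
  then have W_F: "weighted_image scale ?V ?w ?a i \<subseteq> ?F i" for i
    by (rule alg.weighted_image_subset[OF lnd.nfiltration_F lnd.one_mem_F])
  interpret pres: weighted_presentation scale ?V ?w ?a ?F
    using lnd.nfiltration_F F_G G_W W_F by unfold_locales blast+
  have "J_hat r n m d I zp sp = genideal (mpoly_ring ?V) (top_form ?w ` pres.relations)"
    unfolding J_hat_def pres.relations_def
    by (simp only: alg.J_ideal_eq_kernel[OF presentation z_rep s_rep])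
  then show ?thesis
    using pres.assoc_graded_iso by simp
qed

end
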